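(* If $a=(a_i)_{i\in\mathbb Z}$ is given by $a_i=i-\tfrac12$ for all $i\in\mathbb Z$, then $s_{\mu;a}=Fs_\mu$ for every Young diagram $\mu$.
   Context: The base field is $\mathbb C$. $\Lambda=\mathbb C[\mathbf p_1,\mathbf p_2,\dots]$ is the algebra of symmetric functions (polynomial ring in the power sums). Its elements $h_k$ are defined by $H(u)=1+\sum_{k\ge1}h_ku^{-k}=\exp\big(\sum_{k\ge1}\mathbf p_ku^{-k}/k\big)\in\Lambda[[u^{-1}]]$. Multiparameter Schur functions: for a sequence $a=(a_i)_{i\in\mathbb Z}$ of complex numbers, the elements $h_{k;a}\in\Lambda$ are defined by $$1+\sum_{k\ge1}\frac{h_{k;a}}{(u-a_1)\cdots(u-a_k)}=H(u)$$ in $\Lambda[[u^{-1}]]$, with $h_{0;a}=1$ and $h_{k;a}=0$ for $k<0$. For $r\in\mathbb Z$, $(\tau^ra)_i=a_{i+r}$. Then $s_{\mu;a}=\det[h_{\mu_i-i+j;\,\tau^{1-j}a}]$, where the order of the determinant is any number $\ge\ell(\mu)$, the number of nonzero rows of $\mu$. Frobenius--Schur functions: $\Lambda^*_n\subset\mathbb C[x_1,\dots,x_n]$ is the algebra of polynomials symmetric in the variables $x_j-j$, and $\Lambda^*=\varprojlim\Lambda^*_n$ is the projective limit in filtered algebras (filtration by degree) under the maps $x_n=0$. Put $x^{\downarrow m}=x(x-1)\cdots(x-m+1)$, $x^{\downarrow0}=1$. The shifted Schur function $s^*_\mu\in\Lambda^*$ is given for $n\ge\ell(\mu)$ by $$s^*_\mu(x_1,\dots,x_n)=\frac{\det[(x_i+n-i)^{\downarrow(\mu_j+n-j)}]_{i,j=1}^n}{\det[(x_i+n-i)^{\downarrow(n-j)}]_{i,j=1}^n}$$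 (these are compatible for varying $n$). Put $h^*_k=s^*_{(k)}$ and $H^*(u)=1+\sum_{k\ge1}h^*_k/u^{\downarrow k}\in\Lambda^*[[u^{-1}]]$. $\Lambda^*$ is the polynomial algebra in $h_1^*,h_2^*,\dots$, and $\varphi:\Lambda^*\to\Lambda$ is the algebra isomorphism defined (coefficientwise in $u^{-1}$) by $\varphi(H^*(u))=H(u+\tfrac12)$. The Frobenius--Schur function is $Fs_\mu=\varphi(s^*_\mu)$. *)

theory Defs
  imports
    "HOL-Library.Poly_Mapping"
    "HOL-Computational_Algebra.Formal_Power_Series"
    "Jordan_Normal_Form.Determinant"
begin

section \<open>Polynomials in countably many variables\<close>

text \<open>
  The ring \<open>\<complex>[y\<^sub>1, y\<^sub>2, \<dots>]\<close>. It serves both as the algebra of symmetric functions, with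
  \<open>y\<^sub>k = \<^bold>p\<^sub>k\<close>, and as the union of the rings \<open>\<complex>[x\<^sub>1, \<dots>, x\<^sub>n]\<close>, with \<open>y\<^sub>i = x\<^sub>i\<close>.
  All indices of variables, rows and columns are shifted to start at 0, so that \<open>var i\<close>
  stands for \<open>y\<^bsub>i+1\<^esub>\<close>.
\<close>

type_synonym cpoly = "(nat \<Rightarrow>\<^sub>0 nat) \<Rightarrow>\<^sub>0 complex"

definition cst :: "complex \<Rightarrow> cpoly" where
  "cst c = Poly_Mapping.single 0 c"

definition var :: "nat \<Rightarrow> cpoly" where
  "var i = Poly_Mapping.single (Poly_Mapping.single i 1) 1"

definition subst :: "(nat \<Rightarrow> cpoly) \<Rightarrow> cpoly \<Rightarrow> cpoly" where
  "subst \<sigma> p = (\<Sum>m\<in>Poly_Mapping.keys p. cst (Poly_Mapping.lookup p m) *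
                  (\<Prod>i\<in>Poly_Mapping.keys m. \<sigma> i ^ Poly_Mapping.lookup m i))"

definition in_vars :: "nat \<Rightarrow> cpoly \<Rightarrow> bool" where
  "in_vars n p \<longleftrightarrow> (\<forall>m\<in>Poly_Mapping.keys p. Poly_Mapping.keys m \<subseteq> {..<n})"

definition total_degree_le :: "nat \<Rightarrow> cpoly \<Rightarrow> bool" where
  "total_degree_le d p \<longleftrightarrow>
     (\<forall>m\<in>Poly_Mapping.keys p. (\<Sum>i\<in>Poly_Mapping.keys m. Poly_Mapping.lookup m i) \<le> d)"

lemma cst_0 [simp]: "cst 0 = 0" and cst_1 [simp]: "cst 1 = 1"
  by (simp_all add: cst_def)

lemma cst_add: "cst (a + b) = cst a + cst b"
  and cst_mult: "cst (a * b) = cst a * cst b"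
  by (simp_all add: cst_def single_add mult_single)

lemma cst_sum: "cst (sum f A) = (\<Sum>x\<in>A. cst (f x))"
  by (induction A rule: infinite_finite_induct) (simp_all add: cst_add)

lemma subst_mono_superset:
  assumes "finite A" "Poly_Mapping.keys p \<subseteq> A"
  shows "subst \<sigma> p = (\<Sum>m\<in>A. cst (Poly_Mapping.lookup p m) *
           (\<Prod>i\<in>Poly_Mapping.keys m. \<sigma> i ^ Poly_Mapping.lookup m i))"
  unfolding subst_def
  by (rule sum.mono_neutral_left) (use assms in \<open>auto simp: in_keys_iff\<close>)

lemma subst_0 [simp]: "subst \<sigma> 0 = 0"
  by (simp add: subst_def)

lemma subst_add: "subst \<sigma> (p + q) = subst \<sigma> p + subst \<sigma> q"
proof -
  let ?A = "Poly_Mapping.keys p \<union> Poly_Mapping.keys q"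
  have fin: "finite ?A" by simp
  have sub: "Poly_Mapping.keys (p + q) \<subseteq> ?A" by (rule keys_add)
  show ?thesis
    unfolding subst_mono_superset[OF fin sub] subst_mono_superset[OF fin Un_upper1]
      subst_mono_superset[OF fin Un_upper2]
    by (simp add: lookup_add cst_add algebra_simps sum.distrib)
qed

lemma subst_sum: "subst \<sigma> (sum f A) = (\<Sum>x\<in>A. subst \<sigma> (f x))"
  by (induction A rule: infinite_finite_induct) (simp_all add: subst_add)

lemma subst_single:
  "subst \<sigma> (Poly_Mapping.single m c) =
     cst c * (\<Prod>i\<in>Poly_Mapping.keys m. \<sigma> i ^ Poly_Mapping.lookup m i)"
  by (simp add: subst_def)

lemma subst_cst [simp]: "subst \<sigma> (cst c) = cst c"
  by (simp add: cst_def subst_single)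

lemma subst_1 [simp]: "subst \<sigma> 1 = 1"
  using subst_cst[of \<sigma> 1] by simp

lemma subst_var [simp]: "subst \<sigma> (var i) = \<sigma> i"
  by (simp add: var_def subst_single)

lemma monom_eval_add:
  fixes \<sigma> :: "nat \<Rightarrow> cpoly" and m m' :: "nat \<Rightarrow>\<^sub>0 nat"
  shows "(\<Prod>i\<in>Poly_Mapping.keys (m + m'). \<sigma> i ^ Poly_Mapping.lookup (m + m') i) =
   (\<Prod>i\<in>Poly_Mapping.keys m. \<sigma> i ^ Poly_Mapping.lookup m i) *
   (\<Prod>i\<in>Poly_Mapping.keys m'. \<sigma> i ^ Poly_Mapping.lookup m' i)"
proof -
  let ?A = "Poly_Mapping.keys m \<union> Poly_Mapping.keys m'"
  have *: "(\<Prod>i\<in>Poly_Mapping.keys k. \<sigma> i ^ Poly_Mapping.lookup k i) =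
           (\<Prod>i\<in>?A. \<sigma> i ^ Poly_Mapping.lookup k i)"
    if "Poly_Mapping.keys k \<subseteq> ?A" for k :: "nat \<Rightarrow>\<^sub>0 nat"
    by (rule prod.mono_neutral_left) (use that in \<open>auto simp: in_keys_iff\<close>)
  have sub: "Poly_Mapping.keys (m + m') \<subseteq> ?A" by (rule keys_add)
  show ?thesis
    unfolding *[OF sub] *[OF Un_upper1] *[OF Un_upper2]
    by (simp add: lookup_add power_add prod.distrib)
qed

lemma sum_monomials:
  fixes p :: cpoly
  shows "(\<Sum>m\<in>Poly_Mapping.keys p. Poly_Mapping.single m (Poly_Mapping.lookup p m)) = p"
proof (rule poly_mapping_eqI)
  fix k
  show "Poly_Mapping.lookup
          (\<Sum>m\<in>Poly_Mapping.keys p. Poly_Mapping.single m (Poly_Mapping.lookup p m)) k =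
        Poly_Mapping.lookup p k"
    by (simp add: lookup_sum lookup_single when_def sum.delta in_keys_iff)
qed

lemma subst_mult: "subst \<sigma> (p * q) = subst \<sigma> p * subst \<sigma> q"
proof -
  let ?s = "\<lambda>p m. Poly_Mapping.single m (Poly_Mapping.lookup p m) :: cpoly"
  have mono: "subst \<sigma> (?s p m * ?s q m') = subst \<sigma> (?s p m) * subst \<sigma> (?s q m')" for m m'
    by (simp add: mult_single subst_single cst_mult monom_eval_add)
  have "p * q = (\<Sum>m\<in>Poly_Mapping.keys p. ?s p m) * (\<Sum>m'\<in>Poly_Mapping.keys q. ?s q m')"
    by (simp add: sum_monomials)
  also have "subst \<sigma> \<dots> = (\<Sum>m\<in>Poly_Mapping.keys p. \<Sum>m'\<in>Poly_Mapping.keys q.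
      subst \<sigma> (?s p m) * subst \<sigma> (?s q m'))"
    by (simp add: sum_product subst_sum mono)
  also have "\<dots> = subst \<sigma> (\<Sum>m\<in>Poly_Mapping.keys p. ?s p m) *
      subst \<sigma> (\<Sum>m'\<in>Poly_Mapping.keys q. ?s q m')"
    by (simp add: sum_product subst_sum)
  finally show ?thesis by (simp add: sum_monomials)
qed

lemma subst_uminus: "subst \<sigma> (- p) = - subst \<sigma> p"
  using subst_add[of \<sigma> p "- p"] by (simp add: eq_neg_iff_add_eq_0 add.commute)

lemma in_vars_cst [simp]: "in_vars n (cst c)"
  by (auto simp: in_vars_def cst_def)

lemma in_vars_add: "in_vars n p \<Longrightarrow> in_vars n q \<Longrightarrow> in_vars n (p + q)"
  using keys_add[of p q] by (auto simp: in_vars_def)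

lemma in_vars_uminus: "in_vars n p \<Longrightarrow> in_vars n (- p)"
  by (simp add: in_vars_def)

lemma in_vars_mult: 
  assumes "in_vars n p" "in_vars n q"
  shows "in_vars n (p * q)"
  unfolding in_vars_def
proof
  fix m assume "m \<in> Poly_Mapping.keys (p * q)"
  then obtain a b where "m = a + b" "a \<in> Poly_Mapping.keys p" "b \<in> Poly_Mapping.keys q"
    using keys_mult[of p q] by blast
  then show "Poly_Mapping.keys m \<subseteq> {..<n}"
    using assms keys_add[of a b] by (fastforce simp: in_vars_def)
qed

lemma total_degree_le_cst [simp]: "total_degree_le d (cst c)"
  by (auto simp: total_degree_le_def cst_def)

lemma total_degree_le_add:
  "total_degree_le d p \<Longrightarrow> total_degree_le e q \<Longrightarrow> total_degree_le (max d e) (p + q)"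
  using keys_add[of p q] by (fastforce simp: total_degree_le_def)

lemma total_degree_le_uminus: "total_degree_le d p \<Longrightarrow> total_degree_le d (- p)"
  by (simp add: total_degree_le_def)

lemma total_degree_le_mult:
  assumes "total_degree_le d p" "total_degree_le e q"
  shows "total_degree_le (d + e) (p * q)"
  unfolding total_degree_le_def
proof
  fix m assume "m \<in> Poly_Mapping.keys (p * q)"
  then obtain a b where ab: "m = a + b" "a \<in> Poly_Mapping.keys p" "b \<in> Poly_Mapping.keys q"
    using keys_mult[of p q] by blast
  have "(\<Sum>i\<in>Poly_Mapping.keys m. Poly_Mapping.lookup m i) =
        (\<Sum>i\<in>Poly_Mapping.keys a. Poly_Mapping.lookup a i) +
        (\<Sum>i\<in>Poly_Mapping.keys b. Poly_Mapping.lookup b i)"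
    unfolding ab(1) by (rule setsum_keys_plus_distrib) simp_all
  with ab assms show "(\<Sum>i\<in>Poly_Mapping.keys m. Poly_Mapping.lookup m i) \<le> d + e"
    by (auto simp: total_degree_le_def intro: add_mono)
qed


no_notation vec_index (infixl \<open>$\<close> 100)
unbundle fps_syntax

section \<open>Series in \<open>u\<^sup>-\<^sup>1\<close>\<close>

text \<open>Formal power series in the indeterminate \<open>fps_X = u\<^sup>-\<^sup>1\<close>.\<close>

definition map_coeffs :: "('a::zero \<Rightarrow> 'b::zero) \<Rightarrow> 'a fps \<Rightarrow> 'b fps" where
  "map_coeffs f F = Abs_fps (\<lambda>n. f (F $ n))"

text \<open>\<open>1 / ((u - a\<^sub>1) \<cdots> (u - a\<^sub>k)) = u\<^sup>-\<^sup>k / ((1 - a\<^sub>1 u\<^sup>-\<^sup>1) \<cdots> (1 - a\<^sub>k u\<^sup>-\<^sup>1))\<close>\<close>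

definition inv_prod :: "(int \<Rightarrow> complex) \<Rightarrow> nat \<Rightarrow> complex fps" where
  "inv_prod a k = fps_X ^ k * inverse (\<Prod>i=1..k. 1 - fps_const (a (int i)) * fps_X)"

lemma map_coeffs_nth [simp]: "map_coeffs f F $ n = f (F $ n)"
  by (simp add: map_coeffs_def)

lemma inv_prod_nth_less: "n < k \<Longrightarrow> inv_prod a k $ n = 0"
  by (simp add: inv_prod_def fps_X_power_mult_nth)

lemma inv_prod_nth_same: "inv_prod a k $ k = 1"
proof -
  have "(\<Prod>i=1..k. 1 - fps_const (a (int i)) * fps_X) $ 0 = 1"
    by (induction k) (simp_all add: fps_mult_nth)
  then show ?thesis
    by (simp add: inv_prod_def fps_X_power_mult_nth)
qed

lemma inv_prod_0 [simp]: "inv_prod a 0 = 1"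
  by (simp add: inv_prod_def)


section \<open>Multiparameter Schur functions\<close>

definition Hser :: "cpoly fps" where
  "Hser = map_coeffs cst (fps_exp 1) oo
          Abs_fps (\<lambda>k. if k = 0 then 0 else cst (1 / of_nat k) * var (k - 1))"

text \<open>The infinite sum is taken in the \<open>u\<^sup>-\<^sup>1\<close>-adic topology of the ring of power series.\<close>

definition mult_h_expansion :: "(int \<Rightarrow> complex) \<Rightarrow> (nat \<Rightarrow> cpoly) \<Rightarrow> bool" where
  "mult_h_expansion a h \<longleftrightarrow>
     h 0 = 1 \<and> (\<lambda>k. fps_const (h k) * map_coeffs cst (inv_prod a k)) sums Hser"

definition mult_h :: "(int \<Rightarrow> complex) \<Rightarrow> int \<Rightarrow> cpoly" where
  "mult_h a k = (if k < 0 then 0 else (THE h. mult_h_expansion a h) (nat k))"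

definition tau :: "int \<Rightarrow> (int \<Rightarrow> complex) \<Rightarrow> (int \<Rightarrow> complex)" where
  "tau r a = (\<lambda>i. a (i + r))"

text \<open>
  A Young diagram is the list of its nonzero row lengths; its length is \<open>\<ell>(\<mu>)\<close>.
  As rows are counted from 0, \<open>part \<mu> i\<close> is \<open>\<mu>\<^bsub>i+1\<^esub>\<close>.
\<close>

definition young_diagram :: "nat list \<Rightarrow> bool" where
  "young_diagram \<mu> \<longleftrightarrow> sorted_wrt (\<ge>) \<mu> \<and> 0 \<notin> set \<mu>"

definition part :: "nat list \<Rightarrow> nat \<Rightarrow> nat" where
  "part \<mu> i = (if i < length \<mu> then \<mu> ! i else 0)"

text \<open>The entry \<open>(i, j)\<close> is \<open>h\<^bsub>\<mu>\<^sub>I-I+J; \<tau>^(1-J) a\<^esub>\<close> with \<open>I = i + 1\<close>, \<open>J = j + 1\<close>.\<close>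

definition mult_schur_det :: "nat \<Rightarrow> (int \<Rightarrow> complex) \<Rightarrow> nat list \<Rightarrow> cpoly" where
  "mult_schur_det n a \<mu> =
     det (mat n n (\<lambda>(i, j). mult_h (tau (- int j) a) (int (part \<mu> i) - int i + int j)))"

definition mult_schur :: "(int \<Rightarrow> complex) \<Rightarrow> nat list \<Rightarrow> cpoly" where
  "mult_schur a \<mu> = mult_schur_det (length \<mu>) a \<mu>"

text \<open>Well-definedness: existence and uniqueness of the expansion defining \<open>h\<^bsub>k;a\<^esub>\<close>, and
  independence of the determinant from its order.\<close>

lemma fps_triangular_sums_iff:
  fixes c :: "nat \<Rightarrow> 'a::comm_ring_1 fps"
  assumes "\<And>k n. n < k \<Longrightarrow> c k $ n = 0"
  shows "(\<lambda>k. fps_const (h k) * c k) sums F \<longleftrightarrow> (\<forall>n. F $ n = (\<Sum>k\<le>n. h k * c k $ n))"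
proof -
  have stab: "(\<Sum>k<N. fps_const (h k) * c k) $ n = (\<Sum>k\<le>n. h k * c k $ n)" if "N > n" for N n
  proof -
    have "(\<Sum>k<N. fps_const (h k) * c k) $ n = (\<Sum>k<N. h k * c k $ n)"
      by (simp add: fps_sum_nth)
    also have "\<dots> = (\<Sum>k\<le>n. h k * c k $ n)"
      by (rule sum.mono_neutral_right) (use that assms in auto)
    finally show ?thesis .
  qed
  show ?thesis
  proof
    assume "(\<lambda>k. fps_const (h k) * c k) sums F"
    then have ev: "\<forall>\<^sub>F N in sequentially. (\<Sum>k<N. fps_const (h k) * c k) $ n = F $ n" for n
      unfolding sums_def tendsto_fps_iff by blast
    show "\<forall>n. F $ n = (\<Sum>k\<le>n. h k * c k $ n)"
    proof
      fix n
      from eventually_conj[OF ev[of n] eventually_gt_at_top[of n]]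
      obtain N where "(\<Sum>k<N. fps_const (h k) * c k) $ n = F $ n" "N > n"
        unfolding eventually_sequentially by blast
      with stab show "F $ n = (\<Sum>k\<le>n. h k * c k $ n)" by metis
    qed
  next
    assume *: "\<forall>n. F $ n = (\<Sum>k\<le>n. h k * c k $ n)"
    show "(\<lambda>k. fps_const (h k) * c k) sums F"
      unfolding sums_def
    proof (rule tendsto_fpsI)
      fix n
      show "\<forall>\<^sub>F N in sequentially. (\<Sum>k<N. fps_const (h k) * c k) $ n = F $ n"
        using eventually_gt_at_top[of n] by eventually_elim (simp add: stab *)
    qed
  qed
qed

lemma Hser_nth_0: "Hser $ 0 = 1"
  by (simp add: Hser_def)

lemma mult_h_expansion_iff:
  "mult_h_expansion a h \<longleftrightarrow>
     (\<forall>n. Hser $ n = (\<Sum>k\<le>n. h k * cst (inv_prod a k $ n)))"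
proof -
  have "(\<lambda>k. fps_const (h k) * map_coeffs cst (inv_prod a k)) sums Hser \<longleftrightarrow>
     (\<forall>n. Hser $ n = (\<Sum>k\<le>n. h k * cst (inv_prod a k $ n)))"
    by (subst fps_triangular_sums_iff) (simp_all add: inv_prod_nth_less)
  moreover have "h 0 = 1" if "\<forall>n. Hser $ n = (\<Sum>k\<le>n. h k * cst (inv_prod a k $ n))"
    using that[rule_format, of 0] by (simp add: Hser_nth_0)
  ultimately show ?thesis
    unfolding mult_h_expansion_def by blast
qed

fun mult_h_rec :: "(int \<Rightarrow> complex) \<Rightarrow> nat \<Rightarrow> cpoly" where
  "mult_h_rec a n = Hser $ n - (\<Sum>k<n. mult_h_rec a k * cst (inv_prod a k $ n))"

declare mult_h_rec.simps [simp del]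

lemma mult_h_expansion_unique:
  "mult_h_expansion a h \<longleftrightarrow> h = mult_h_rec a"
proof -
  have split: "(\<Sum>k\<le>n. g k * cst (inv_prod a k $ n)) =
        (\<Sum>k<n. g k * cst (inv_prod a k $ n)) + g n" for g n
    by (simp add: lessThan_Suc_atMost[symmetric] inv_prod_nth_same)
  have "h n = mult_h_rec a n" if "mult_h_expansion a h" for n
  proof (induction n rule: less_induct)
    case (less n)
    then have "Hser $ n = (\<Sum>k<n. mult_h_rec a k * cst (inv_prod a k $ n)) + h n"
      using that by (simp add: mult_h_expansion_iff split)
    then show ?case
      by (subst mult_h_rec.simps) simp
  qed
  moreover have "mult_h_expansion a (mult_h_rec a)"
    unfolding mult_h_expansion_iff split
  proof
    fix n
    show "Hser $ n = (\<Sum>k<n. mult_h_rec a k * cst (inv_prod a k $ n)) + mult_h_rec a n"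
      by (subst (2) mult_h_rec.simps) simp
  qed
  ultimately show ?thesis by blast
qed

lemma mult_h_well_defined: "\<exists>!h. mult_h_expansion a h"
  by (simp add: mult_h_expansion_unique)

lemma mult_h_expansion_mult_h: "mult_h_expansion a (\<lambda>k. mult_h a (int k))"
  using theI'[OF mult_h_well_defined, of a] by (simp add: mult_h_def)

lemma mult_h_0 [simp]: "mult_h a 0 = 1"
  using mult_h_expansion_mult_h[of a] by (simp add: mult_h_expansion_def)

lemma mult_h_neg: "k < 0 \<Longrightarrow> mult_h a k = 0"
  by (simp add: mult_h_def)

lemma mult_schur_det_order:
  assumes "length \<mu> \<le> n"
  shows "mult_schur_det n a \<mu> = mult_schur a \<mu>"
  using assms
proof (induction rule: dec_induct)
  case base
  show ?case by (simp add: mult_schur_def)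
next
  case (step n)
  let ?f = "\<lambda>(i, j). mult_h (tau (- int j) a) (int (part \<mu> i) - int i + int j)"
  let ?A = "mat n n ?f" and ?B = "mat n 1 (\<lambda>(i, j). ?f (i, n))" and ?C = "mat 1 1 (\<lambda>_. 1 :: cpoly)"
  have "mat (Suc n) (Suc n) ?f = four_block_mat ?A ?B (0\<^sub>m 1 n) ?C"
    by (rule eq_matI)
      (use step.hyps in \<open>auto simp: part_def mult_h_neg less_Suc_eq\<close>)
  then have "mult_schur_det (Suc n) a \<mu> = det ?A * det ?C"
    unfolding mult_schur_det_def
    by (simp only:) (rule det_four_block_mat_lower_left_zero, auto)
  also have "det ?C = 1"
    by (subst det_upper_triangular[of _ 1]) (auto simp: diag_mat_def)
  finally show ?case
    using step.IH by (simp add: mult_schur_det_def)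
qed


section \<open>Shifted symmetric functions\<close>

definition symmetric_in :: "nat \<Rightarrow> cpoly \<Rightarrow> bool" where
  "symmetric_in n g \<longleftrightarrow>
     in_vars n g \<and> (\<forall>\<pi>. \<pi> permutes {..<n} \<longrightarrow> subst (\<lambda>i. var (\<pi> i)) g = g)"

text \<open>\<open>\<Lambda>\<^sup>*\<^sub>n\<close>: the polynomials \<open>g(x\<^sub>1 - 1, \<dots>, x\<^sub>n - n)\<close> with \<open>g\<close> symmetric.\<close>

definition shifted_symmetric :: "nat \<Rightarrow> cpoly set" where
  "shifted_symmetric n = {subst (\<lambda>i. var i - of_nat (Suc i)) g | g. symmetric_in n g}"

text \<open>The map \<open>\<Lambda>\<^sup>*\<^bsub>n+1\<^esub> \<rightarrow> \<Lambda>\<^sup>*\<^sub>n\<close> that puts \<open>x\<^bsub>n+1\<^esub> = 0\<close>.\<close>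

definition restrict_to :: "nat \<Rightarrow> cpoly \<Rightarrow> cpoly" where
  "restrict_to n = subst (\<lambda>i. if i = n then 0 else var i)"

lemma symmetric_in_cst: "symmetric_in n (cst c)"
  by (simp add: symmetric_in_def)

lemma symmetric_in_add: "symmetric_in n f \<Longrightarrow> symmetric_in n g \<Longrightarrow> symmetric_in n (f + g)"
  by (simp add: symmetric_in_def in_vars_add subst_add)

lemma symmetric_in_mult: "symmetric_in n f \<Longrightarrow> symmetric_in n g \<Longrightarrow> symmetric_in n (f * g)"
  by (simp add: symmetric_in_def in_vars_mult subst_mult)

lemma symmetric_in_uminus: "symmetric_in n f \<Longrightarrow> symmetric_in n (- f)"
  by (simp add: symmetric_in_def in_vars_uminus subst_uminus)

lemma shifted_symmetric_cst: "cst c \<in> shifted_symmetric n"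
  unfolding shifted_symmetric_def
  by (rule CollectI, rule exI[of _ "cst c"]) (simp add: symmetric_in_cst)

lemma shifted_symmetric_add:
  "f \<in> shifted_symmetric n \<Longrightarrow> g \<in> shifted_symmetric n \<Longrightarrow> f + g \<in> shifted_symmetric n"
  unfolding shifted_symmetric_def by clarify (metis subst_add symmetric_in_add)

lemma shifted_symmetric_mult:
  "f \<in> shifted_symmetric n \<Longrightarrow> g \<in> shifted_symmetric n \<Longrightarrow> f * g \<in> shifted_symmetric n"
  unfolding shifted_symmetric_def by clarify (metis subst_mult symmetric_in_mult)

lemma shifted_symmetric_uminus:
  "f \<in> shifted_symmetric n \<Longrightarrow> - f \<in> shifted_symmetric n"
  unfolding shifted_symmetric_def by clarify (metis subst_uminus symmetric_in_uminus)

text \<open>The projective limit \<open>\<Lambda>\<^sup>*\<close> of filtered algebras: compatible sequences of bounded degree.\<close>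

typedef lambda_star = "{f :: nat \<Rightarrow> cpoly.
    (\<forall>n. f n \<in> shifted_symmetric n) \<and>
    (\<forall>n. restrict_to n (f (Suc n)) = f n) \<and>
    (\<exists>d. \<forall>n. total_degree_le d (f n))}"
  morphisms component Abs_lambda_star
  by (rule exI[of _ "\<lambda>_. cst 0"])
    (auto simp del: cst_0 simp: shifted_symmetric_cst restrict_to_def)

setup_lifting type_definition_lambda_star

instantiation lambda_star :: comm_ring_1
begin

lift_definition zero_lambda_star :: lambda_star is "\<lambda>_. cst 0"
  by (auto simp del: cst_0 simp: shifted_symmetric_cst restrict_to_def)

lift_definition one_lambda_star :: lambda_star is "\<lambda>_. cst 1"
  by (auto simp del: cst_1 simp: shifted_symmetric_cst restrict_to_def)

lift_definition plus_lambda_star :: "lambda_star \<Rightarrow> lambda_star \<Rightarrow> lambda_star"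
  is "\<lambda>f g n. f n + g n"
  by (auto simp: shifted_symmetric_add restrict_to_def subst_add)
    (meson total_degree_le_add)

lift_definition times_lambda_star :: "lambda_star \<Rightarrow> lambda_star \<Rightarrow> lambda_star"
  is "\<lambda>f g n. f n * g n"
  by (auto simp: shifted_symmetric_mult restrict_to_def subst_mult)
    (meson total_degree_le_mult)

lift_definition uminus_lambda_star :: "lambda_star \<Rightarrow> lambda_star"
  is "\<lambda>f n. - f n"
  by (auto simp: shifted_symmetric_uminus restrict_to_def subst_uminus)
    (meson total_degree_le_uminus)

definition minus_lambda_star :: "lambda_star \<Rightarrow> lambda_star \<Rightarrow> lambda_star" where
  "minus_lambda_star f g = f + (- g)"

instance
proof
  fix a b c :: lambda_star
  show "a * b * c = a * (b * c)" by transfer (simp add: mult.assoc)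
  show "a * b = b * a" by transfer (simp add: mult.commute)
  show "1 * a = a" by transfer simp
  show "a + b + c = a + (b + c)" by transfer (simp add: add.assoc)
  show "a + b = b + a" by transfer (simp add: add.commute)
  show "0 + a = a" by transfer simp
  show "- a + a = 0" by transfer simp
  show "a - b = a + - b" by (rule minus_lambda_star_def)
  show "(a + b) * c = a * c + b * c" by transfer (simp add: distrib_right)
  show "(0 :: lambda_star) \<noteq> 1" by transfer (simp add: fun_eq_iff)
qed

end

lift_definition star_cst :: "complex \<Rightarrow> lambda_star" is "\<lambda>c _. cst c"
  by (auto simp: shifted_symmetric_cst restrict_to_def)


section \<open>Shifted Schur functions\<close>

definition falling :: "cpoly \<Rightarrow> nat \<Rightarrow> cpoly" where
  "falling x m = (\<Prod>l<m. x - of_nat l)"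

definition falling_det :: "nat \<Rightarrow> nat list \<Rightarrow> cpoly" where
  "falling_det n \<mu> =
     det (mat n n (\<lambda>(i, j). falling (var i + of_nat (n - Suc i)) (part \<mu> j + (n - Suc j))))"

text \<open>The quotient of determinants is expressed in the integral domain of polynomials: its value
  in \<open>n\<close> variables is the polynomial whose product with the denominator (the determinant of the
  empty diagram) is the numerator. The components with \<open>n < \<ell>(\<mu>)\<close> are then determined by
  restriction.\<close>

definition shifted_schur :: "nat list \<Rightarrow> lambda_star" where
  "shifted_schur \<mu> =
     (THE f. \<forall>n\<ge>length \<mu>. component f n * falling_det n [] = falling_det n \<mu>)"

text \<open>\<open>u\<^bsup>\<down>k\<^esup> = (u - a\<^sub>1) \<cdots> (u - a\<^sub>k)\<close> for \<open>a\<^sub>i = i - 1\<close>; the sum is in the \<open>u\<^sup>-\<^sup>1\<close>-adic topology.\<close>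

definition Hstar :: "lambda_star fps" where
  "Hstar = 1 + suminf (\<lambda>k. fps_const (shifted_schur [Suc k]) *
                             map_coeffs star_cst (inv_prod (\<lambda>i. of_int (i - 1)) (Suc k)))"

lemma star_cst_0 [simp]: "star_cst 0 = 0" and star_cst_1 [simp]: "star_cst 1 = 1"
  by (transfer; simp)+

lemma Hstar_nth:
  "Hstar $ n = (if n = 0 then 1 else 0) +
     (\<Sum>k<n. shifted_schur [Suc k] * star_cst (inv_prod (\<lambda>i. of_int (i - 1)) (Suc k) $ n))"
proof -
  let ?c = "\<lambda>k. map_coeffs star_cst (inv_prod (\<lambda>i. of_int (i - 1)) (Suc k))"
  let ?h = "\<lambda>k. shifted_schur [Suc k]"
  have "(\<lambda>k. fps_const (?h k) * ?c k) sums Abs_fps (\<lambda>n. \<Sum>k\<le>n. ?h k * ?c k $ n)"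
    by (subst fps_triangular_sums_iff) (simp_all add: inv_prod_nth_less)
  then have "Hstar $ n = (if n = 0 then 1 else 0) + (\<Sum>k\<le>n. ?h k * ?c k $ n)"
    unfolding Hstar_def by (simp add: sums_unique[symmetric])
  also have "(\<Sum>k\<le>n. ?h k * ?c k $ n) = (\<Sum>k<n. ?h k * ?c k $ n)"
    by (simp add: lessThan_Suc_atMost[symmetric] inv_prod_nth_less)
  finally show ?thesis by simp
qed


section \<open>Frobenius--Schur functions\<close>

text \<open>\<open>H(u + 1/2)\<close>, using \<open>(u + 1/2)\<^sup>-\<^sup>1 = u\<^sup>-\<^sup>1 / (1 + u\<^sup>-\<^sup>1 / 2)\<close>\<close>

definition Hser_half :: "cpoly fps" where
  "Hser_half = Hser oo map_coeffs cst (fps_X * inverse (1 + fps_const (1/2) * fps_X))"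

definition algebra_iso :: "(lambda_star \<Rightarrow> cpoly) \<Rightarrow> bool" where
  "algebra_iso \<phi> \<longleftrightarrow> bij \<phi> \<and>
     (\<forall>f g. \<phi> (f + g) = \<phi> f + \<phi> g) \<and>
     (\<forall>f g. \<phi> (f * g) = \<phi> f * \<phi> g) \<and>
     (\<forall>c. \<phi> (star_cst c) = cst c)"

text \<open>The characterisation of \<open>\<phi>\<close>; the second condition is \<open>\<phi>(H\<^sup>*(u)) = H(u + 1/2)\<close>, coefficientwise in \<open>u\<^sup>-\<^sup>1\<close>.\<close>

definition frobenius_iso :: "(lambda_star \<Rightarrow> cpoly) \<Rightarrow> bool" where
  "frobenius_iso \<phi> \<longleftrightarrow> algebra_iso \<phi> \<and> map_coeffs \<phi> Hstar = Hser_half"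

definition frobenius_schur :: "(lambda_star \<Rightarrow> cpoly) \<Rightarrow> nat list \<Rightarrow> cpoly" where
  "frobenius_schur \<phi> \<mu> = \<phi> (shifted_schur \<mu>)"

end

theory Submission
  imports Defs
begin

text \<open>
  Both sides of the identity are determinants of the same Jacobi--Trudi shape, so the theorem
  reduces to two facts.

  The first is a Jacobi--Trudi formula for shifted Schur functions. In \<open>n\<close> variables
  \<open>H\<^sup>*(u) = \<Prod>\<^sub>i (u + i) / (u + i - x\<^sub>i)\<close>. Put \<open>z\<^sub>i = x\<^sub>i - i\<close>, \<open>v = u + n\<close> and
  \<open>y\<^sub>i = z\<^sub>i + n = x\<^sub>i + n - i\<close>, so that \<open>H\<^sup>*(u) = v\<^bsup>\<down>n\<^esup> / \<Prod>\<^sub>l (v - y\<^sub>l)\<close>, and expand, for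
  each \<open>j \<ge> 0\<close>, \<open>H\<^sup>*(u) = \<Sum>\<^sub>k h\<^bsub>j,k\<^esub> / (u + j)\<^bsup>\<down>k\<^esup>\<close>. The generating function
  \<open>\<Sum>\<^sub>m y\<^sub>i\<^bsup>\<down>m\<^esup> / v\<^bsup>\<down>m+1\<^esup> = 1 / (v - y\<^sub>i)\<close> of the entries of the determinants in the definition
  of \<open>s\<^sup>*\<^sub>\<mu>\<close> equals \<open>\<Prod>\<^bsub>l \<noteq> i\<^esub> (v - y\<^sub>l) \<cdot> H\<^sup>*(u) / v\<^bsup>\<down>n\<^esup>\<close>. The product over \<open>l \<noteq> i\<close> is a
  combination \<open>\<Sum>\<^bsub>j<n\<^esub> c\<^bsub>i,j\<^esub> (u + j)\<^bsup>\<down>j\<^esup>\<close>, and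
  \<open>(u + j)\<^bsup>\<down>j\<^esup> / v\<^bsup>\<down>n\<^esup> = 1 / v\<^bsup>\<down>n-j\<^esup>\<close> while \<open>v\<^bsup>\<down>n-j\<^esup> (u + j)\<^bsup>\<down>k\<^esup> = v\<^bsup>\<down>n-j+k\<^esup>\<close>.
  Comparing the coefficients of \<open>1 / v\<^bsup>\<down>m+1\<^esup>\<close> gives \<open>y\<^sub>i\<^bsup>\<down>m\<^esup> = \<Sum>\<^bsub>j<n\<^esub> c\<^bsub>i,j\<^esub> h\<^bsub>j,m+1-n+j\<^esub>\<close>
  (lemma \<open>falling_linear_in_complete\<close>). For \<open>m = \<mu>\<^sub>r + n - r\<close> this factors the numerator matrix of
  \<open>s\<^sup>*\<^sub>\<mu>\<close> as \<open>(c\<^bsub>i,j\<^esub>)\<close> times the transposed Jacobi--Trudi matrix of \<open>\<mu>\<close>; for the empty diagram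
  the latter is unitriangular, so \<open>det (c\<^bsub>i,j\<^esub>)\<close> is the denominator and the quotient is
  the Jacobi--Trudi determinant (lemmas \<open>jacobi_trudi_falling_det\<close> and
  \<open>shifted_schur_jacobi_trudi\<close>). The case of one row shows that the product above really is
  \<open>H\<^sup>*(u)\<close> (lemma \<open>Hstar_eq_complete_star\<close>).

  The second fact is that \<open>\<phi>\<close> matches the entries. Substituting \<open>u + 1/2\<close> for \<open>u\<close> in the
  expansion of \<open>H(u)\<close> that defines \<open>h\<^bsub>k;b\<^esub>\<close> with \<open>b = \<tau>\<^bsup>-j\<^esup>a\<close>, the denominator becomes
  \<open>(u + 1/2 - b\<^sub>1) \<cdots> (u + 1/2 - b\<^sub>k) = (u + j)\<^bsup>\<down>k\<^esup>\<close>, because \<open>a\<^sub>i - 1/2 = i - 1\<close>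
  (lemma \<open>expands_Hser_half\<close>). As \<open>\<phi>\<close> maps \<open>H\<^sup>*(u)\<close> to \<open>H(u + 1/2)\<close>, it follows that
  \<open>\<phi>(h\<^bsub>j,k\<^esub>) = h\<^bsub>k;\<tau>\<^bsup>-j\<^esup>a\<^esub>\<close>, and \<open>\<phi>\<close> commutes with determinants.
\<close>

section \<open>Coefficient homomorphisms\<close>

lemma comm_ring_hom_subst: "comm_ring_hom (subst \<sigma>)"
  by unfold_locales (simp_all add: subst_add subst_mult)

lemma comm_ring_hom_cst: "comm_ring_hom cst"
  by unfold_locales (simp_all add: cst_add cst_mult)

lemma comm_ring_hom_star_cst: "comm_ring_hom star_cst"
  by unfold_locales (simp_all, (transfer, simp add: cst_add cst_mult)+)

lemma comm_ring_hom_component: "comm_ring_hom (\<lambda>f. component f n)"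
  by unfold_locales
    (simp_all add: zero_lambda_star.rep_eq one_lambda_star.rep_eq plus_lambda_star.rep_eq
      times_lambda_star.rep_eq)

interpretation subst: comm_ring_hom "subst \<sigma>" for \<sigma>
  by (rule comm_ring_hom_subst)

interpretation cst: comm_ring_hom cst
  by (rule comm_ring_hom_cst)

interpretation component: comm_ring_hom "\<lambda>f. component f n" for n
  by (rule comm_ring_hom_component)

lemma comm_ring_hom_map_coeffs:
  assumes "comm_ring_hom f"
  shows "comm_ring_hom (map_coeffs f)"
proof -
  interpret comm_ring_hom f by (fact assms)
  show ?thesis
    by unfold_locales (auto simp: fps_eq_iff fps_mult_nth hom_distribs)
qed

lemma map_coeffs_fps_X [simp]: "f 0 = 0 \<Longrightarrow> f 1 = 1 \<Longrightarrow> map_coeffs f fps_X = fps_X"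
  by (simp add: fps_eq_iff fps_X_def)

lemma map_coeffs_fps_const [simp]: "f 0 = 0 \<Longrightarrow> map_coeffs f (fps_const c) = fps_const (f c)"
  by (simp add: fps_eq_iff)

lemma map_coeffs_map_coeffs: "map_coeffs f (map_coeffs g F) = map_coeffs (\<lambda>x. f (g x)) F"
  by (simp add: fps_eq_iff)

lemma component_star_cst [simp]: "component (star_cst c) n = cst c"
  by transfer simp

section \<open>Expansions in a triangular basis\<close>

text \<open>
  The coefficientwise form of \<open>F = \<Sum>\<^sub>k h\<^sub>k B\<^sub>k\<close>: the sum over \<open>k \<le> m\<close> is the whole coefficient
  as soon as \<open>B\<^sub>k\<close> is divisible by \<open>X\<^sup>k\<close>.
\<close>

definition expands :: "(nat \<Rightarrow> 'a::comm_ring_1 fps) \<Rightarrow> (nat \<Rightarrow> 'a) \<Rightarrow> 'a fps \<Rightarrow> bool" where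
  "expands B h F \<longleftrightarrow> (\<forall>m. F $ m = (\<Sum>k\<le>m. h k * B k $ m))"

definition unitriangular :: "(nat \<Rightarrow> 'a::comm_ring_1 fps) \<Rightarrow> bool" where
  "unitriangular B \<longleftrightarrow> (\<forall>k. B k $ k = 1 \<and> (\<forall>m<k. B k $ m = 0))"

lemma unitriangular_sum:
  assumes "unitriangular B" "m < N"
  shows "(\<Sum>k<N. fps_const (h k) * B k) $ m = (\<Sum>k\<le>m. h k * B k $ m)"
proof -
  have "(\<Sum>k<N. h k * B k $ m) = (\<Sum>k\<le>m. h k * B k $ m)"
    by (rule sum.mono_neutral_right) (use assms in \<open>auto simp: unitriangular_def\<close>)
  then show ?thesis by (simp add: fps_sum_nth)
qed

lemma expands_truncate:
  assumes "unitriangular B" "expands B h F"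
  obtains R where "F = (\<Sum>k<M. fps_const (h k) * B k) + fps_X ^ M * R"
proof
  let ?D = "F - (\<Sum>k<M. fps_const (h k) * B k)"
  \<comment> \<open>Below order \<open>M\<close> the partial sum already agrees with \<open>F\<close>.\<close>
  have "?D = fps_X ^ M * fps_shift M ?D"
    using assms(2) unitriangular_sum[OF assms(1), of _ M h]
    by (auto simp: fps_eq_iff fps_X_power_mult_nth expands_def)
  then show "F = (\<Sum>k<M. fps_const (h k) * B k) + fps_X ^ M * fps_shift M ?D"
    by (simp add: algebra_simps)
qed

text \<open>
  The length \<open>N\<close> of the partial sum may exceed the order \<open>M\<close> of the remainder, so that an
  expansion whose indices are shifted can be recognised without cutting terms off.
\<close>

lemma expandsI_truncate:
  assumes "unitriangular B"
    and "\<And>M. \<exists>N\<ge>M. \<exists>R. F = (\<Sum>k<N. fps_const (h k) * B k) + fps_X ^ M * R"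
  shows "expands B h F"
  unfolding expands_def
proof
  fix m
  obtain N R where "N \<ge> Suc m" and F: "F = (\<Sum>k<N. fps_const (h k) * B k) + fps_X ^ Suc m * R"
    using assms(2) by blast
  have "F $ m = (\<Sum>k<N. fps_const (h k) * B k) $ m"
    unfolding F fps_add_nth fps_X_power_mult_nth by simp
  then show "F $ m = (\<Sum>k\<le>m. h k * B k $ m)"
    using \<open>N \<ge> Suc m\<close> by (simp add: unitriangular_sum[OF assms(1)])
qed

lemma expands_unique:
  assumes "unitriangular B" "expands B g F" "expands B h F"
  shows "g k = h k"
proof (induction k rule: less_induct)
  case (less k)
  have "(\<Sum>l\<le>k. g l * B l $ k) = (\<Sum>l\<le>k. h l * B l $ k)"
    using assms(2,3) by (simp add: expands_def)
  with less assms(1) show ?case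
    by (simp add: lessThan_Suc_atMost[symmetric] unitriangular_def)
qed

lemma expands_nth_0:
  assumes "unitriangular B" "expands B h F"
  shows "h 0 = F $ 0"
  using assms(2)[unfolded expands_def, rule_format, of 0] assms(1)
  by (simp add: unitriangular_def)

lemma expands_linear_combination:
  assumes "\<And>j. j \<in> S \<Longrightarrow> expands B (h j) (F j)"
  shows "expands B (\<lambda>k. \<Sum>j\<in>S. c j * h j k) (\<Sum>j\<in>S. fps_const (c j) * F j)"
  unfolding expands_def
proof
  fix m
  have "(\<Sum>j\<in>S. fps_const (c j) * F j) $ m = (\<Sum>j\<in>S. c j * (\<Sum>k\<le>m. h j k * B k $ m))"
    using assms by (simp add: fps_sum_nth expands_def)
  also have "\<dots> = (\<Sum>k\<le>m. (\<Sum>j\<in>S. c j * h j k) * B k $ m)"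
    by (simp add: sum_distrib_left sum_distrib_right mult.assoc sum.swap[of _ S])
  finally show "(\<Sum>j\<in>S. fps_const (c j) * F j) $ m = (\<Sum>k\<le>m. (\<Sum>j\<in>S. c j * h j k) * B k $ m)" .
qed

text \<open>
  Multiplication by \<open>1 / v\<^bsup>\<down>m\<^esup>\<close> turns \<open>1 / (v - m)\<^bsup>\<down>k\<^esup>\<close> into \<open>1 / v\<^bsup>\<down>m+k\<^esup>\<close>; this is the
  abstract form. The coefficients are indexed by integers, as in the Jacobi--Trudi matrix, so
  that the first \<open>m\<close> coefficients of the product are the values of \<open>h\<close> at negative arguments.
\<close>

lemma expands_shift:
  assumes B: "unitriangular B" and B': "unitriangular B'" and F: "expands B' (\<lambda>k. h (int k)) F"
    and neg: "\<And>k. k < 0 \<Longrightarrow> h k = 0"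
    and D: "\<And>k. B (m + k) = D * B' k"
  shows "expands B (\<lambda>k. h (int k - int m)) (D * F)"
proof (rule expandsI_truncate[OF B])
  fix M
  obtain R where R: "F = (\<Sum>k<M. fps_const (h (int k)) * B' k) + fps_X ^ M * R"
    using expands_truncate[OF B' F] .
  have "(\<Sum>k<m+M. fps_const (h (int k - int m)) * B k) =
        (\<Sum>k\<in>{m..<m+M}. fps_const (h (int k - int m)) * B k)"
    by (rule sum.mono_neutral_right) (auto simp: neg)
  also have "\<dots> = (\<Sum>k<M. fps_const (h (int k)) * B (m + k))"
    by (rule sum.reindex_bij_witness[of _ "\<lambda>k. m + k" "\<lambda>k. k - m"]) auto
  also have "\<dots> = D * (\<Sum>k<M. fps_const (h (int k)) * B' k)"
    by (simp add: D sum_distrib_left mult_ac)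
  finally have "D * F = (\<Sum>k<m+M. fps_const (h (int k - int m)) * B k) + fps_X ^ M * (D * R)"
    by (simp add: R algebra_simps)
  then show "\<exists>N\<ge>M. \<exists>R. D * F = (\<Sum>k<N. fps_const (h (int k - int m)) * B k) + fps_X ^ M * R"
    by (intro exI[of _ "m + M"]) auto
qed

lemma expands_hom:
  assumes "comm_ring_hom f" "expands B h F"
  shows "expands (\<lambda>k. map_coeffs f (B k)) (\<lambda>k. f (h k)) (map_coeffs f F)"
proof -
  interpret comm_ring_hom f by (fact assms(1))
  show ?thesis using assms(2) by (simp add: expands_def hom_distribs)
qed

text \<open>The solution of the triangular system for the coefficients of an expansion.\<close>

fun expansion_coeff :: "(nat \<Rightarrow> 'a::comm_ring_1 fps) \<Rightarrow> 'a fps \<Rightarrow> nat \<Rightarrow> 'a" where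
  "expansion_coeff B F m = F $ m - (\<Sum>k<m. expansion_coeff B F k * B k $ m)"

declare expansion_coeff.simps [simp del]

lemma expands_expansion_coeff:
  assumes "unitriangular B"
  shows "expands B (expansion_coeff B F) F"
  unfolding expands_def
proof
  fix m
  show "F $ m = (\<Sum>k\<le>m. expansion_coeff B F k * B k $ m)"
    using assms expansion_coeff.simps[of B F m]
    by (simp add: lessThan_Suc_atMost[symmetric] unitriangular_def)
qed

section \<open>Geometric series and inverse falling products\<close>

lemma inv_prod_Suc:
  "inv_prod a (Suc k) * (1 - fps_const (a (int k + 1)) * fps_X) = fps_X * inv_prod a k"
proof -
  let ?q = "1 - fps_const (a (int k + 1)) * fps_X"
  have "inverse ?q * ?q = 1"
    by (rule inverse_mult_eq_1) simp
  then show ?thesis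
    by (simp add: inv_prod_def fps_inverse_mult add.commute mult_ac)
qed

text \<open>
  The source of the shifts \<open>\<tau>\<^bsup>1-j\<^esup>\<close> in the columns of the Jacobi--Trudi determinant:
  splitting off the first \<open>m\<close> factors moves the parameter sequence.
\<close>

lemma inv_prod_add: "inv_prod a (m + k) = inv_prod a m * inv_prod (tau (int m) a) k"
proof (induction k)
  case (Suc k)
  let ?q = "1 - fps_const (a (int (m + k) + 1)) * fps_X"
  have "?q $ 0 \<noteq> 0" by simp
  then have q: "?q \<noteq> 0" by (metis fps_zero_nth)
  have "inv_prod a (m + Suc k) * ?q = fps_X * inv_prod a (m + k)"
    using inv_prod_Suc[of a "m + k"] by simp
  also have "\<dots> = inv_prod a m * (fps_X * inv_prod (tau (int m) a) k)"
    by (simp add: Suc.IH mult_ac)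
  also have "\<dots> = inv_prod a m * inv_prod (tau (int m) a) (Suc k) * ?q"
    using inv_prod_Suc[of "tau (int m) a" k] by (simp add: tau_def add_ac mult.assoc)
  finally show ?case using q by (metis mult_right_cancel)
qed simp

text \<open>The inverse of \<open>1 - zX\<close>, available over rings without division; \<open>X\<close> times it is
  \<open>1 / (u - z)\<close>.\<close>

definition geometric :: "'a::comm_ring_1 \<Rightarrow> 'a fps" where
  "geometric z = Abs_fps (\<lambda>m. z ^ m)"

lemma geometric_mult: "(1 - fps_const z * fps_X) * geometric z = 1"
proof (rule fps_ext)
  fix m
  show "((1 - fps_const z * fps_X) * geometric z) $ m = 1 $ m"
    by (cases m) (simp_all add: geometric_def left_diff_distrib mult.assoc fps_X_mult_nth)
qed

text \<open>\<open>(u + n)\<^bsup>\<down>n\<^esup> = (u + 1) \<cdots> (u + n)\<close> divided by \<open>u\<^sup>n\<close>.\<close>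

definition rising :: "nat \<Rightarrow> 'a::comm_ring_1 fps" where
  "rising n = (\<Prod>i<n. 1 + fps_const (of_nat (Suc i)) * fps_X)"

lemma rising_nth_0 [simp]: "rising n $ 0 = 1"
  by (induction n) (simp_all add: rising_def)

lemma unitriangular_inv_prod:
  assumes "comm_ring_hom f"
  shows "unitriangular (\<lambda>k. map_coeffs f (inv_prod b k))"
proof -
  interpret comm_ring_hom f by (fact assms)
  show ?thesis by (simp add: unitriangular_def inv_prod_nth_same inv_prod_nth_less)
qed

text \<open>
  Newton interpolation of \<open>1 / (u - z)\<close>: its coefficient at \<open>1 / ((u - b\<^sub>1) \<cdots> (u - b\<^bsub>m+1\<^esub>))\<close> is
  \<open>(z - b\<^sub>1) \<cdots> (z - b\<^sub>m)\<close>. One step of the interpolation is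
  \<open>(u - b) / (u - z) = 1 + (z - b) / (u - z)\<close> for the next node \<open>b\<close>.
\<close>

lemma expands_geometric:
  assumes "comm_ring_hom f"
  shows "expands (\<lambda>k. map_coeffs f (inv_prod b k))
           (\<lambda>k. if k = 0 then 0 else \<Prod>l<k - 1. z - f (b (int l + 1)))
           (fps_X * geometric z)"
    (is "expands ?B ?h _")
proof (rule expandsI_truncate[OF unitriangular_inv_prod[OF assms]])
  interpret comm_ring_hom f by (fact assms)
  interpret map_coeffs: comm_ring_hom "map_coeffs f"
    by (rule comm_ring_hom_map_coeffs[OF assms])
  let ?y = "\<lambda>m. \<Prod>l<m. z - f (b (int l + 1))"
  have B_Suc: "?B (Suc k) * (1 - fps_const (f (b (int k + 1))) * fps_X) = fps_X * ?B k" for k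
    using arg_cong[OF inv_prod_Suc[of b k], of "map_coeffs f"]
    by (simp add: map_coeffs.hom_mult map_coeffs.hom_minus)
  \<comment> \<open>the interpolation formula with its exact remainder after \<open>M\<close> nodes\<close>
  have main: "fps_X * geometric z =
      (\<Sum>k<Suc M. fps_const (?h k) * ?B k) + fps_const (?y M) * ?B M * (fps_X * geometric z)" for M
  proof (induction M)
    case (Suc M)
    let ?b = "f (b (int M + 1))"
    have "(1 - fps_const ?b * fps_X) * geometric z =
          (1 - fps_const z * fps_X) * geometric z + fps_const (z - ?b) * (fps_X * geometric z)"
      by (simp add: algebra_simps flip: fps_const_sub)
    then have step: "(1 - fps_const ?b * fps_X) * geometric z =
        1 + fps_const (z - ?b) * (fps_X * geometric z)"
      by (simp only: geometric_mult)
    have "?B M * (fps_X * geometric z) = ?B (Suc M) * ((1 - fps_const ?b * fps_X) * geometric z)"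
      by (simp only: mult.assoc[symmetric] B_Suc) (simp add: mult_ac)
    also have "\<dots> = ?B (Suc M) + fps_const (z - ?b) * ?B (Suc M) * (fps_X * geometric z)"
      unfolding step by (simp add: algebra_simps)
    finally have "?B M * (fps_X * geometric z) =
        ?B (Suc M) + fps_const (z - ?b) * ?B (Suc M) * (fps_X * geometric z)" .
    then have "fps_const (?y M) * ?B M * (fps_X * geometric z) =
        fps_const (?y M) * (?B (Suc M) + fps_const (z - ?b) * ?B (Suc M) * (fps_X * geometric z))"
      by (simp only: mult.assoc)
    also have "\<dots> =
        fps_const (?y M) * ?B (Suc M) + fps_const (?y (Suc M)) * ?B (Suc M) * (fps_X * geometric z)"
      by (simp only: distrib_left mult.assoc prod.lessThan_Suc fps_const_mult[symmetric])
    finally have "fps_const (?y M) * ?B M * (fps_X * geometric z) =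
        fps_const (?y M) * ?B (Suc M) + fps_const (?y (Suc M)) * ?B (Suc M) * (fps_X * geometric z)" .
    moreover have "?h (Suc M) = ?y M" by simp
    ultimately show ?case
      by (subst (1) Suc.IH) (simp only: sum.lessThan_Suc[of _ "Suc M"] add.assoc)
  qed simp
  fix M
  have "?B M = fps_X ^ M * fps_shift M (?B M)"
    by (auto simp: fps_eq_iff fps_X_power_mult_nth inv_prod_nth_less)
  then obtain S where "?B M = fps_X ^ M * S" by blast
  then have "fps_const (?y M) * ?B M * (fps_X * geometric z) =
      fps_X ^ M * (fps_const (?y M) * S * (fps_X * geometric z))"
    by (simp only: mult_ac)
  with main[of M] show "\<exists>N\<ge>M. \<exists>R. fps_X * geometric z =
      (\<Sum>k<N. fps_const (?h k) * ?B k) + fps_X ^ M * R"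
    by (intro exI[of _ "Suc M"] conjI exI[of _ "fps_const (?y M) * S * (fps_X * geometric z)"])
      simp_all
qed

text \<open>
  Divided by \<open>u\<^bsup>d\<^esup>\<close> with \<open>d = |S|\<close>, this expands the polynomial \<open>\<Prod>\<^bsub>l\<in>S\<^esub> (u - z\<^sub>l)\<close> in the
  basis \<open>(u + 1) \<cdots> (u + j)\<close>, \<open>j \<le> d\<close>. Only the existence of the coefficients matters: they
  enter the final formula through a determinant that cancels. The induction uses
  \<open>u - z = (u + j + 1) - (z + j + 1)\<close>.
\<close>

lemma prod_linear_in_rising_basis:
  fixes z :: "'b \<Rightarrow> 'a::comm_ring_1"
  assumes "finite S"
  shows "\<exists>c. (\<Prod>l\<in>S. 1 - fps_const (z l) * fps_X) =
           (\<Sum>j\<le>card S. fps_const (c j) * (fps_X ^ (card S - j) * rising j))"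
  using assms
proof (induction S rule: finite_induct)
  case empty
  show ?case by (intro exI[of _ "\<lambda>_. 1"]) (simp add: rising_def)
next
  case (insert s S)
  let ?d = "card S"
  from insert.IH obtain c where c: "(\<Prod>l\<in>S. 1 - fps_const (z l) * fps_X) =
      (\<Sum>j\<le>?d. fps_const (c j) * (fps_X ^ (?d - j) * rising j))" by blast
  define e where "e j = (if j = 0 then 0 else c (j - 1)) -
      (if j \<le> ?d then c j * (z s + of_nat (Suc j)) else 0)" for j
  let ?T = "\<lambda>j. fps_X ^ (Suc ?d - j) * rising j :: 'a fps"
  have step: "(1 - fps_const (z s) * fps_X) * (fps_X ^ (?d - j) * rising j) =
      ?T (Suc j) - fps_const (z s + of_nat (Suc j)) * ?T j" if "j \<le> ?d" for j
  proof -
    have "?T (Suc j) = fps_X ^ (?d - j) * rising j * (1 + fps_const (of_nat (Suc j)) * fps_X)"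
      by (simp add: rising_def mult_ac)
    moreover have "?T j = fps_X * fps_X ^ (?d - j) * rising j"
      using that by (simp add: Suc_diff_le)
    ultimately show ?thesis
      by (simp add: algebra_simps flip: fps_const_add)
  qed
  have "(\<Prod>l\<in>insert s S. 1 - fps_const (z l) * fps_X) =
      (\<Sum>j\<le>?d. fps_const (c j) * ((1 - fps_const (z s) * fps_X) * (fps_X ^ (?d - j) * rising j)))"
    using insert.hyps by (simp add: c sum_distrib_left mult.left_commute)
  also have "\<dots> = (\<Sum>j\<le>?d. fps_const (c j) * ?T (Suc j)) -
      (\<Sum>j\<le>?d. fps_const (c j * (z s + of_nat (Suc j))) * ?T j)"
    unfolding sum_subtractf[symmetric]
    by (rule sum.cong) (simp_all only: step atMost_iff right_diff_distrib fps_const_mult[symmetric] mult.assoc)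
  also have "(\<Sum>j\<le>?d. fps_const (c j) * ?T (Suc j)) =
      (\<Sum>j\<le>Suc ?d. fps_const (if j = 0 then 0 else c (j - 1)) * ?T j)"
    unfolding sum.atMost_Suc_shift by simp
  also have "(\<Sum>j\<le>?d. fps_const (c j * (z s + of_nat (Suc j))) * ?T j) =
      (\<Sum>j\<le>Suc ?d. fps_const (if j \<le> ?d then c j * (z s + of_nat (Suc j)) else 0) * ?T j)"
    by simp
  finally have "(\<Prod>l\<in>insert s S. 1 - fps_const (z l) * fps_X) = (\<Sum>j\<le>Suc ?d. fps_const (e j) * ?T j)"
    by (simp only: sum_subtractf[symmetric] left_diff_distrib[symmetric] fps_const_sub e_def)
  then show ?case using insert.hyps by (intro exI[of _ e]) simp
qed

section \<open>The generating series in finitely many variables\<close>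

text \<open>\<open>H\<^sup>*(u)\<close> in the variables \<open>z\<^sub>i = x\<^sub>i - i\<close>, in which it is symmetric.\<close>

definition complete_series :: "nat \<Rightarrow> (nat \<Rightarrow> 'a::comm_ring_1) \<Rightarrow> 'a fps" where
  "complete_series n z = rising n * (\<Prod>i<n. geometric (z i))"

lemma map_coeffs_geometric:
  assumes "comm_ring_hom f"
  shows "map_coeffs f (geometric z) = geometric (f z)"
proof -
  interpret comm_ring_hom f by (fact assms)
  show ?thesis by (simp add: fps_eq_iff geometric_def hom_distribs)
qed

lemma map_coeffs_rising:
  assumes "comm_ring_hom f"
  shows "map_coeffs f (rising n) = rising n"
proof -
  interpret comm_ring_hom f by (fact assms)
  interpret map_coeffs: comm_ring_hom "map_coeffs f"
    by (rule comm_ring_hom_map_coeffs[OF assms])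
  show ?thesis
    by (simp add: rising_def map_coeffs.hom_prod map_coeffs.hom_add map_coeffs.hom_mult
        hom_distribs del: of_nat_Suc)
qed

lemma map_coeffs_complete_series:
  assumes "comm_ring_hom f"
  shows "map_coeffs f (complete_series n z) = complete_series n (\<lambda>i. f (z i))"
proof -
  interpret map_coeffs: comm_ring_hom "map_coeffs f"
    by (rule comm_ring_hom_map_coeffs[OF assms])
  show ?thesis
    by (simp add: complete_series_def map_coeffs.hom_mult map_coeffs.hom_prod
        map_coeffs_rising[OF assms] map_coeffs_geometric[OF assms])
qed

lemma complete_series_nth_0 [simp]: "complete_series n z $ 0 = 1"
proof -
  have "(\<Prod>i<n. geometric (z i)) $ 0 = 1"
    by (induction n) (simp_all add: geometric_def)
  then show ?thesis by (simp add: complete_series_def)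
qed

text \<open>Stability: \<open>x\<^bsub>n+1\<^esub> = 0\<close> means \<open>z\<^bsub>n+1\<^esub> = -(n + 1)\<close>, where the last factor
  \<open>(u + n + 1) / (u - z\<^bsub>n+1\<^esub>)\<close> is 1.\<close>

lemma complete_series_Suc:
  assumes "z n = - of_nat (Suc n)"
  shows "complete_series (Suc n) z = complete_series n z"
proof -
  have "1 - fps_const (z n) * fps_X = 1 + fps_const (of_nat (Suc n)) * fps_X"
    by (simp add: assms fps_eq_iff del: of_nat_Suc)
  then have cancel: "(1 + fps_const (of_nat (Suc n)) * fps_X) * geometric (z n) = 1"
    using geometric_mult[of "z n"] by metis
  have "complete_series (Suc n) z =
      complete_series n z * ((1 + fps_const (of_nat (Suc n)) * fps_X) * geometric (z n))"
    by (simp only: complete_series_def rising_def prod.lessThan_Suc mult_ac)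
  then show ?thesis
    by (simp only: cancel mult_1_right)
qed

lemma complete_series_permute:
  assumes "\<pi> permutes {..<n}"
  shows "complete_series n (\<lambda>i. z (\<pi> i)) = complete_series n z"
  using prod.permute[OF assms, of "\<lambda>i. geometric (z i)"]
  by (simp add: complete_series_def comp_def)

text \<open>
  For an algebra filtration \<open>P\<close>, the series with \<open>m\<close>-th coefficient in \<open>P m\<close> form a ring. This
  gives at once the degree bound (\<open>P d\<close>: degree at most \<open>d\<close>) and the restriction on the
  variables that occur (\<open>P\<close> constant).
\<close>

lemma complete_series_filtration:
  assumes cst: "\<And>d c. P d (cst c)"
    and add: "\<And>d p q. P d p \<Longrightarrow> P d q \<Longrightarrow> P d (p + q)"
    and mult: "\<And>d e p q. P d p \<Longrightarrow> P e q \<Longrightarrow> P (d + e) (p * q)"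
    and z: "\<And>i. i < n \<Longrightarrow> P 1 (z i)"
  shows "P m (complete_series n z $ m)"
proof -
  define Q where "Q F \<longleftrightarrow> (\<forall>m. P m (F $ m))" for F
  have P_sum: "P d (sum f A)" if "\<And>x. x \<in> A \<Longrightarrow> P d (f x)" for d f and A :: "nat set"
    using that cst[of d 0] add by (induction A rule: infinite_finite_induct) auto
  have P_of_nat: "P d (of_nat k)" for d k
    using cst[of d "of_nat k"] by (simp only: cst.hom_of_nat)
  have Q_mult: "Q (F * G)" if F: "Q F" and G: "Q G" for F G
    unfolding Q_def
  proof
    fix m
    have "P (i + (m - i)) (F $ i * G $ (m - i))" for i
      using F G mult unfolding Q_def by blast
    then show "P m ((F * G) $ m)"
      unfolding fps_mult_nth by (intro P_sum) (metis atLeastAtMost_iff le_add_diff_inverse)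
  qed
  have Q_1: "Q 1"
    using cst[of _ 0] cst[of _ 1] by (auto simp: Q_def)
  have Q_prod: "Q (prod F A)" if "\<And>i. i \<in> A \<Longrightarrow> Q (F i)" for F and A :: "nat set"
    using that Q_1 Q_mult by (induction A rule: infinite_finite_induct) auto
  have "Q (1 + fps_const (of_nat k) * fps_X)" for k
    using cst[of _ 0] cst[of _ 1] P_of_nat by (auto simp: Q_def fps_X_def)
  then have "Q (rising n)"
    unfolding rising_def by (intro Q_prod) blast
  moreover have "Q (geometric (z i))" if "i < n" for i
    unfolding Q_def
  proof
    fix m
    show "P m (geometric (z i) $ m)"
    proof (induction m)
      case 0
      show ?case using cst[of 0 1] by (simp add: geometric_def)
    next
      case (Suc m)
      show ?case using mult[OF z[OF that] Suc.IH] by (simp add: geometric_def)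
    qed
  qed
  ultimately show ?thesis
    using Q_mult Q_prod[of "{..<n}" "\<lambda>i. geometric (z i)"]
    by (auto simp: complete_series_def Q_def)
qed

section \<open>Jacobi--Trudi factorization of the falling factorial determinants\<close>

text \<open>The basis \<open>1 / (u + j)\<^bsup>\<down>k\<^esup>\<close>, with coefficients in a \<open>\<complex>\<close>-algebra whose structure map is \<open>f\<close>.\<close>

definition shifted_basis :: "(complex \<Rightarrow> 'a::comm_ring_1) \<Rightarrow> nat \<Rightarrow> nat \<Rightarrow> 'a fps" where
  "shifted_basis f j k = map_coeffs f (inv_prod (\<lambda>i. of_int (i - 1) - of_nat j) k)"

lemma map_coeffs_shifted_basis:
  "map_coeffs f (shifted_basis g j k) = shifted_basis (\<lambda>c. f (g c)) j k"
  by (simp add: shifted_basis_def map_coeffs_map_coeffs)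

lemma unitriangular_shifted_basis: "comm_ring_hom f \<Longrightarrow> unitriangular (shifted_basis f j)"
  unfolding shifted_basis_def by (rule unitriangular_inv_prod)

text \<open>\<open>(u + n)\<^bsup>\<down>n\<^esup> / (u + n)\<^bsup>\<down>m\<^esup> = (u + n - m)\<^bsup>\<down>n-m\<^esup>\<close>, divided by \<open>u\<^sup>n\<close>.\<close>

lemma shifted_basis_mult_rising:
  assumes "comm_ring_hom f" "m \<le> n"
  shows "shifted_basis f n m * rising n = fps_X ^ m * rising (n - m)"
proof -
  interpret f: comm_ring_hom f by (fact assms(1))
  interpret map_coeffs: comm_ring_hom "map_coeffs f"
    by (rule comm_ring_hom_map_coeffs[OF assms(1)])
  let ?b = "\<lambda>i :: int. of_int (i - 1) - of_nat n :: complex"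
  have "inv_prod ?b m * rising n = fps_X ^ m * rising (n - m)"
    using assms(2)
  proof (induction m)
    case (Suc m)
    let ?q = "1 + fps_const (of_nat (n - m)) * fps_X :: complex fps"
    have "?q $ 0 \<noteq> 0" by simp
    then have q: "?q \<noteq> 0" by (metis fps_zero_nth)
    have q': "1 - fps_const (?b (int m + 1)) * fps_X = ?q"
      using Suc.prems by (simp add: of_nat_diff fps_eq_iff)
    have "n - m = Suc (n - Suc m)" using Suc.prems by simp
    then have ris: "rising (n - m) = rising (n - Suc m) * ?q"
      by (simp add: rising_def)
    have "inv_prod ?b (Suc m) * rising n * ?q = inv_prod ?b (Suc m) * ?q * rising n"
      by (simp only: mult_ac)
    also have "\<dots> = fps_X * (inv_prod ?b m * rising n)"
      by (simp only: inv_prod_Suc[of ?b m, unfolded q'] mult.assoc)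
    also have "\<dots> = fps_X ^ Suc m * rising (n - Suc m) * ?q"
      using Suc by (simp add: ris mult.assoc)
    finally show ?case using q by (metis mult_right_cancel)
  qed simp
  from arg_cong[OF this, of "map_coeffs f"] show ?thesis
    by (simp add: shifted_basis_def map_coeffs.hom_mult map_coeffs.hom_power
        map_coeffs_rising[OF assms(1)])
qed

lemma shifted_basis_add:
  assumes "comm_ring_hom f" "j \<le> n"
  shows "shifted_basis f n (n - j + k) = shifted_basis f n (n - j) * shifted_basis f j k"
proof -
  interpret map_coeffs: comm_ring_hom "map_coeffs f"
    by (rule comm_ring_hom_map_coeffs[OF assms(1)])
  have "tau (int (n - j)) (\<lambda>i. of_int (i - 1) - of_nat n :: complex) =
        (\<lambda>i. of_int (i - 1) - of_nat j)"
    using assms(2) by (auto simp: tau_def of_nat_diff)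
  then show ?thesis
    unfolding shifted_basis_def by (simp only: inv_prod_add map_coeffs.hom_mult)
qed

text \<open>
  Multiplying \<open>H\<^sup>*(u)\<close> by \<open>\<Prod>\<^bsub>l \<noteq> i\<^esub> (u - z\<^sub>l)\<close> leaves only the \<open>i\<close>-th pole. The
  common denominator \<open>rising n\<close> is cleared first and cancelled at the end, in the integral
  domain of series.
\<close>

lemma geometric_in_complete_series:
  fixes z :: "nat \<Rightarrow> cpoly"
  assumes "i < n"
  shows "\<exists>c. fps_X * geometric (z i) =
    (\<Sum>j<n. fps_const (c j) * (shifted_basis cst n (n - j) * complete_series n z))"
proof -
  let ?S = "{..<n} - {i}"
  have "{..card ?S} = {..<n}" "card ?S = n - 1" using assms by auto
  then obtain c where c: "(\<Prod>l\<in>?S. 1 - fps_const (z l) * fps_X) =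
      (\<Sum>j<n. fps_const (c j) * (fps_X ^ (n - 1 - j) * rising j))"
    using prod_linear_in_rising_basis[of ?S z] by auto
  have cancel: "(\<Prod>l\<in>?S. 1 - fps_const (z l) * fps_X) * (\<Prod>l\<in>?S. geometric (z l)) = 1"
    by (simp add: prod.distrib[symmetric] geometric_mult)
  have "(\<Prod>l<n. geometric (z l)) = geometric (z i) * (\<Prod>l\<in>?S. geometric (z l))"
    using assms by (intro prod.remove) auto
  then have "complete_series n z = rising n * geometric (z i) * (\<Prod>l\<in>?S. geometric (z l))"
    by (simp only: complete_series_def mult.assoc)
  then have "fps_X * (\<Prod>l\<in>?S. 1 - fps_const (z l) * fps_X) * complete_series n z =
      rising n * (fps_X * geometric (z i)) *
        ((\<Prod>l\<in>?S. 1 - fps_const (z l) * fps_X) * (\<Prod>l\<in>?S. geometric (z l)))"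
    by (simp only: mult_ac)
  then have "rising n * (fps_X * geometric (z i)) =
      fps_X * (\<Prod>l\<in>?S. 1 - fps_const (z l) * fps_X) * complete_series n z"
    by (simp only: cancel mult_1_right)
  also have "\<dots> = (\<Sum>j<n. fps_const (c j) * (fps_X ^ (n - j) * rising j * complete_series n z))"
    unfolding c sum_distrib_left sum_distrib_right
  proof (rule sum.cong[OF refl])
    fix j assume "j \<in> {..<n}"
    then have "n - j = Suc (n - 1 - j)" by simp
    then have pow: "fps_X ^ (n - j) = fps_X * (fps_X ^ (n - 1 - j) :: cpoly fps)"
      by (simp only: power_Suc)
    show "fps_X * (fps_const (c j) * (fps_X ^ (n - 1 - j) * rising j)) * complete_series n z =
        fps_const (c j) * (fps_X ^ (n - j) * rising j * complete_series n z)"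
      unfolding pow by (simp only: mult_ac)
  qed
  also have "\<dots> = rising n *
      (\<Sum>j<n. fps_const (c j) * (shifted_basis cst n (n - j) * complete_series n z))"
    unfolding sum_distrib_left
  proof (rule sum.cong[OF refl])
    fix j assume "j \<in> {..<n}"
    then have "fps_X ^ (n - j) * rising j = shifted_basis cst n (n - j) * rising n"
      using shifted_basis_mult_rising[OF comm_ring_hom_cst, of "n - j" n] by simp
    then show "fps_const (c j) * (fps_X ^ (n - j) * rising j * complete_series n z) =
        rising n * (fps_const (c j) * (shifted_basis cst n (n - j) * complete_series n z))"
      by (simp only: mult_ac)
  qed
  finally have eq: "rising n * (fps_X * geometric (z i)) = rising n *
      (\<Sum>j<n. fps_const (c j) * (shifted_basis cst n (n - j) * complete_series n z))" .
  have "rising n $ 0 \<noteq> (0 :: cpoly)" by simp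
  then have "rising n \<noteq> (0 :: cpoly fps)" by (metis fps_zero_nth)
  from mult_left_cancel[THEN iffD1, OF this eq] show ?thesis
    by (rule exI[of _ c])
qed

text \<open>
  Both sides are the coefficient of \<open>1 / (u + n)\<^bsup>\<down>m+1\<^esup>\<close> in \<open>1 / (u - z\<^sub>i)\<close>: the left one by Newton
  interpolation, the right one through the expansions of \<open>H\<^sup>*(u)\<close>. The same coefficients \<open>c\<close>
  serve all \<open>m\<close>, which is what makes the matrix factorization possible.
\<close>

lemma falling_linear_in_complete:
  fixes z :: "nat \<Rightarrow> cpoly"
  assumes h: "\<And>j. expands (shifted_basis cst j) (\<lambda>k. h j (int k)) (complete_series n z)"
    and neg: "\<And>j k. k < 0 \<Longrightarrow> h j k = 0"
    and i: "i < n"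
  shows "\<exists>c. \<forall>m. falling (z i + of_nat n) m =
           (\<Sum>j<n. c j * h j (int m + 1 - int n + int j))"
proof -
  let ?B = "shifted_basis cst n"
  note U = unitriangular_shifted_basis[OF comm_ring_hom_cst]
  obtain c where c: "fps_X * geometric (z i) =
      (\<Sum>j<n. fps_const (c j) * (?B (n - j) * complete_series n z))"
    using geometric_in_complete_series[OF i, of z] by blast
  have "expands ?B (\<lambda>k. \<Sum>j<n. c j * h j (int k - int (n - j))) (fps_X * geometric (z i))"
    unfolding c
  proof (rule expands_linear_combination)
    fix j assume "j \<in> {..<n}"
    then have "?B (n - j + k) = ?B (n - j) * shifted_basis cst j k" for k
      by (intro shifted_basis_add comm_ring_hom_cst) simp
    with neg show "expands ?B (\<lambda>k. h j (int k - int (n - j))) (?B (n - j) * complete_series n z)"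
      by (rule expands_shift[where h = "h j", OF U U h])
  qed
  moreover have "expands ?B (\<lambda>k. if k = 0 then 0 else falling (z i + of_nat n) (k - 1))
      (fps_X * geometric (z i))"
  proof -
    have "z i - cst (of_int (int l + 1 - 1) - of_nat n) = z i + of_nat n - of_nat l" for l
      by (simp add: cst.hom_minus cst.hom_of_nat)
    then show ?thesis
      using expands_geometric[OF comm_ring_hom_cst, of "\<lambda>i. of_int (i - 1) - of_nat n" "z i"]
      by (simp only: falling_def shifted_basis_def[abs_def])
  qed
  ultimately have eq: "(if k = 0 then 0 else falling (z i + of_nat n) (k - 1)) =
      (\<Sum>j<n. c j * h j (int k - int (n - j)))" for k
    by (rule expands_unique[OF U, rotated])
  have "falling (z i + of_nat n) m = (\<Sum>j<n. c j * h j (int m + 1 - int n + int j))" for m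
  proof -
    have index: "int (Suc m) - int (n - j) = int m + 1 - int n + int j" if "j < n" for j
      using that by (simp add: of_nat_diff)
    have "falling (z i + of_nat n) m = (\<Sum>j<n. c j * h j (int (Suc m) - int (n - j)))"
      using eq[of "Suc m"] by simp
    also have "\<dots> = (\<Sum>j<n. c j * h j (int m + 1 - int n + int j))"
      by (rule sum.cong) (simp_all only: lessThan_iff index)
    finally show ?thesis .
  qed
  then show ?thesis by blast
qed

abbreviation shifted_var :: "nat \<Rightarrow> cpoly" where
  "shifted_var i \<equiv> var i - of_nat (Suc i)"

text \<open>
  The matrix of falling factorials for any diagram is one fixed matrix, depending only on \<open>n\<close>,
  times the transposed Jacobi--Trudi matrix. The empty diagram identifies the determinant of
  the fixed matrix.
\<close>

lemma jacobi_trudi_falling_det: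
  assumes h: "\<And>j. expands (shifted_basis cst j) (\<lambda>k. h j (int k)) (complete_series n shifted_var)"
    and neg: "\<And>j k. k < 0 \<Longrightarrow> h j k = 0"
  shows "det (mat n n (\<lambda>(i, j). h j (int (part \<mu> i) - int i + int j))) * falling_det n [] =
         falling_det n \<mu>"
proof -
  let ?J = "\<lambda>\<mu>. mat n n (\<lambda>(i, j). h j (int (part \<mu> i) - int i + int j))"
  have "\<forall>i\<in>{..<n}. \<exists>c. \<forall>m. falling (shifted_var i + of_nat n) m =
      (\<Sum>j<n. c j * h j (int m + 1 - int n + int j))"
    by (intro ballI falling_linear_in_complete[OF h neg]) simp_all
  from bchoice[OF this] obtain c where "\<forall>i\<in>{..<n}. \<forall>m. falling (shifted_var i + of_nat n) m =
      (\<Sum>j<n. c i j * h j (int m + 1 - int n + int j))" ..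
  then have c: "falling (shifted_var i + of_nat n) m =
      (\<Sum>j<n. c i j * h j (int m + 1 - int n + int j))" if "i < n" for i m
    using that by blast
  let ?C = "mat n n (\<lambda>(i, j). c i j)"
  have fact: "falling_det n \<nu> = det ?C * det (?J \<nu>)" for \<nu>
  proof -
    have "mat n n (\<lambda>(i, r). falling (var i + of_nat (n - Suc i)) (part \<nu> r + (n - Suc r))) =
        ?C * transpose_mat (?J \<nu>)"
    proof (rule eq_matI)
      fix i r
      assume "i < dim_row (?C * transpose_mat (?J \<nu>))" "r < dim_col (?C * transpose_mat (?J \<nu>))"
      then have ir: "i < n" "r < n" by simp_all
      have y: "var i + of_nat (n - Suc i) = shifted_var i + of_nat n"
        using ir by (simp add: of_nat_diff)
      have "falling (var i + of_nat (n - Suc i)) (part \<nu> r + (n - Suc r)) =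
          (\<Sum>j<n. c i j * h j (int (part \<nu> r + (n - Suc r)) + 1 - int n + int j))"
        unfolding y by (rule c[OF ir(1)])
      also have "\<dots> = (\<Sum>j<n. c i j * h j (int (part \<nu> r) - int r + int j))"
        using ir by (intro sum.cong) (auto simp: of_nat_diff algebra_simps)
      finally show "mat n n (\<lambda>(i, r). falling (var i + of_nat (n - Suc i)) (part \<nu> r + (n - Suc r)))
          $$ (i, r) = (?C * transpose_mat (?J \<nu>)) $$ (i, r)"
        using ir by (simp add: scalar_prod_def atLeast0LessThan)
    qed simp_all
    then show ?thesis
      unfolding falling_det_def
      by (simp add: det_mult[of _ n] det_transpose[of _ n])
  qed
  have "h j 0 = 1" for j
    using expands_nth_0[OF unitriangular_shifted_basis[OF comm_ring_hom_cst] h[of j]]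
    by (simp only: complete_series_nth_0 of_nat_0)
  then have "det (?J []) = 1"
    by (subst det_upper_triangular[of _ n])
      (auto simp: part_def neg prod_list_diag_prod)
  then show ?thesis
    using fact[of \<mu>] fact[of "[]"] by (simp add: mult.commute)
qed

section \<open>The Jacobi--Trudi formula for shifted Schur functions\<close>

text \<open>
  At \<open>x = 0\<close> the entries are \<open>(n - i)\<^bsup>\<down>n-j\<^esup>\<close>, which vanish for \<open>j < i\<close> and are factorials
  for \<open>i = j\<close>.
\<close>

lemma falling_det_empty_nonzero: "falling_det n [] \<noteq> 0"
proof -
  let ?M = "mat n n (\<lambda>(i, j). falling (var i + of_nat (n - Suc i)) (n - Suc j))"
  define A where "A = map_mat (subst (\<lambda>_. 0)) ?M"
  have dim: "A \<in> carrier_mat n n" "dim_row A = n"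
    by (simp_all add: A_def)
  have entry: "A $$ (i, j) = (\<Prod>l<n - Suc j. of_nat (n - Suc i) - of_nat l)" if "i < n" "j < n" for i j
    using that
    by (simp add: A_def falling_def subst.hom_prod subst.hom_minus subst.hom_add subst.hom_of_nat)
  have "upper_triangular A"
  proof
    fix i j assume ij: "j < i" "i < dim_row A"
    then have mem: "n - Suc i \<in> {..<n - Suc j}" using dim by auto
    have "A $$ (i, j) = (\<Prod>l<n - Suc j. of_nat (n - Suc i) - of_nat l)"
      by (rule entry) (use ij dim in auto)
    also have "\<dots> = 0"
    proof (rule prod_zero)
      show "\<exists>l\<in>{..<n - Suc j}. of_nat (n - Suc i) - of_nat l = (0 :: cpoly)"
        by (rule bexI[OF _ mem]) simp
    qed simp
    finally show "A $$ (i, j) = 0" .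
  qed
  then have "det A = (\<Prod>i=0..<n. A $$ (i, i))"
    using det_upper_triangular[of A n] dim by (simp add: prod_list_diag_prod)
  moreover have "A $$ (i, i) \<noteq> 0" if "i < n" for i
    unfolding entry[OF that that] prod_zero_iff[OF finite_lessThan] right_minus_eq of_nat_eq_iff
    by auto
  ultimately have "det A \<noteq> 0"
    by simp
  moreover have "falling_det n [] = det ?M"
    by (simp add: falling_det_def part_def)
  ultimately show ?thesis
    using subst.hom_det[of "\<lambda>_. 0" ?M] subst.hom_zero unfolding A_def by metis
qed

lemma lambda_star_eqI:
  assumes "\<And>n. n \<ge> N \<Longrightarrow> component f n = component g n"
  shows "f = g"
proof -
  have "component f n = component g n" for n
  proof (cases "n \<ge> N")
    case False
    then have "n \<le> N" by simp
    then show ?thesis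
    proof (induction rule: inc_induct)
      case (step n)
      have "restrict_to n (component f (Suc n)) = component f n" for f
        using component[of f] by simp
      with step.IH show ?case by metis
    qed (simp add: assms)
  qed (simp add: assms)
  then show ?thesis
    by (simp add: component_inject[symmetric] fun_eq_iff)
qed

text \<open>
  In the integral domain of polynomials the quotient of determinants is unique, so any element
  of \<open>\<Lambda>\<^sup>*\<close> with the right components is the shifted Schur function.
\<close>

lemma shifted_schur_eqI:
  assumes "\<And>n. n \<ge> length \<mu> \<Longrightarrow> component f n * falling_det n [] = falling_det n \<mu>"
  shows "shifted_schur \<mu> = f"
  unfolding shifted_schur_def
proof (rule the_equality)
  fix g assume "\<forall>n\<ge>length \<mu>. component g n * falling_det n [] = falling_det n \<mu>"
  then have "component g n * falling_det n [] = component f n * falling_det n []"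
    if "n \<ge> length \<mu>" for n
    using assms[OF that] that by simp
  then show "g = f"
    using falling_det_empty_nonzero by (intro lambda_star_eqI[of "length \<mu>"]) simp
qed (use assms in blast)

lemma shifted_symmetric_complete_series:
  "complete_series n shifted_var $ m \<in> shifted_symmetric n"
proof -
  let ?g = "complete_series n var $ m"
  have coeff: "f ?g = complete_series n (\<lambda>i. f (var i)) $ m" if "comm_ring_hom f" for f
    using arg_cong[OF map_coeffs_complete_series[OF that, of n var], of "\<lambda>F. F $ m"]
    by (simp only: map_coeffs_nth)
  have "in_vars n (var i)" if "i < n" for i
    using that by (auto simp: in_vars_def var_def)
  then have "in_vars n ?g"
    using complete_series_filtration[of "\<lambda>_. in_vars n" n var m]
    by (simp add: in_vars_add in_vars_mult)
  moreover have "subst (\<lambda>i. var (\<pi> i)) ?g = ?g" if "\<pi> permutes {..<n}" for \<pi>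
    using complete_series_permute[OF that, of var] by (simp add: coeff[OF comm_ring_hom_subst])
  ultimately have "symmetric_in n ?g"
    by (simp add: symmetric_in_def)
  moreover have "complete_series n shifted_var $ m = subst shifted_var ?g"
    by (simp add: coeff[OF comm_ring_hom_subst])
  ultimately show ?thesis
    unfolding shifted_symmetric_def by blast
qed

lemma restrict_to_complete_series:
  "restrict_to n (complete_series (Suc n) shifted_var $ m) = complete_series n shifted_var $ m"
proof -
  let ?z = "\<lambda>i. restrict_to n (shifted_var i)"
  have z: "?z i = (if i = n then 0 else var i) - of_nat (Suc i)" for i
    by (simp add: restrict_to_def subst.hom_minus subst.hom_of_nat del: of_nat_Suc)
  have hom: "comm_ring_hom (restrict_to n)"
    unfolding restrict_to_def by (rule comm_ring_hom_subst)
  have "restrict_to n (complete_series (Suc n) shifted_var $ m) = complete_series (Suc n) ?z $ m"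
    using arg_cong[OF map_coeffs_complete_series[OF hom, of "Suc n" shifted_var], of "\<lambda>F. F $ m"]
    by (simp only: map_coeffs_nth)
  also have "complete_series (Suc n) ?z = complete_series n ?z"
    by (rule complete_series_Suc) (simp add: z del: of_nat_Suc)
  also have "complete_series n ?z = complete_series n shifted_var"
    unfolding complete_series_def
    by (intro arg_cong2[where f = "(*)"] refl prod.cong) (simp_all add: z del: of_nat_Suc)
  finally show ?thesis .
qed

lemma total_degree_complete_series:
  "total_degree_le m (complete_series n shifted_var $ m)"
proof (rule complete_series_filtration)
  show "total_degree_le d (p + q)" if "total_degree_le d p" "total_degree_le d q" for d p q
    using total_degree_le_add[OF that] by simp
  show "total_degree_le 1 (shifted_var i)" for i
  proof -
    have "total_degree_le 1 (var i)"
      by (simp add: total_degree_le_def var_def)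
    moreover have "total_degree_le 1 (cst (- of_nat (Suc i)))"
      by simp
    ultimately have "total_degree_le (max 1 1) (var i + cst (- of_nat (Suc i)))"
      by (rule total_degree_le_add)
    then show ?thesis
      by (simp add: cst.hom_uminus cst.hom_of_nat del: of_nat_Suc)
  qed
qed (simp_all add: total_degree_le_mult)

lift_definition complete_coeff :: "nat \<Rightarrow> lambda_star"
  is "\<lambda>m n. complete_series n shifted_var $ m"
  subgoal for m
    by (intro conjI allI exI[of _ m] shifted_symmetric_complete_series
        restrict_to_complete_series total_degree_complete_series)
  done

text \<open>The product \<open>\<Prod>\<^sub>i (u + i) / (u + i - x\<^sub>i)\<close> in infinitely many variables.\<close>

definition complete_star :: "lambda_star fps" where
  "complete_star = Abs_fps complete_coeff"

lemma map_coeffs_component_complete_star: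
  "map_coeffs (\<lambda>f. component f n) complete_star = complete_series n shifted_var"
  by (simp add: fps_eq_iff complete_star_def complete_coeff.rep_eq)

text \<open>
  The hypothesis that all large determinants agree is the independence of the Jacobi--Trudi
  determinant from its order; each use of the lemma has its own reason for it.
\<close>

lemma shifted_schur_jacobi_trudi:
  assumes h: "\<And>j. expands (shifted_basis star_cst j) (\<lambda>k. h j (int k)) complete_star"
    and neg: "\<And>j k. k < 0 \<Longrightarrow> h j k = 0"
    and f: "\<And>n. n \<ge> length \<mu> \<Longrightarrow> det (mat n n (\<lambda>(i, j). h j (int (part \<mu> i) - int i + int j))) = f"
  shows "shifted_schur \<mu> = f"
proof (rule shifted_schur_eqI)
  fix n assume "n \<ge> length \<mu>"
  let ?c = "\<lambda>f. component f n"
  let ?J = "mat n n (\<lambda>(i, j). h j (int (part \<mu> i) - int i + int j))"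
  have "expands (shifted_basis cst j) (\<lambda>k. ?c (h j (int k))) (complete_series n shifted_var)" for j
    using expands_hom[OF comm_ring_hom_component h[of j], of n]
    by (simp only: map_coeffs_component_complete_star map_coeffs_shifted_basis component_star_cst)
  then have "det (mat n n (\<lambda>(i, j). ?c (h j (int (part \<mu> i) - int i + int j)))) * falling_det n [] =
      falling_det n \<mu>"
    by (rule jacobi_trudi_falling_det) (simp add: neg)
  also have "mat n n (\<lambda>(i, j). ?c (h j (int (part \<mu> i) - int i + int j))) = map_mat ?c ?J"
    by (rule eq_matI) auto
  finally show "component f n * falling_det n [] = falling_det n \<mu>"
    using f[OF \<open>n \<ge> length \<mu>\<close>] by (simp add: component.hom_det)
qed

text \<open>
  \<open>H\<^sup>*(u)\<close> is defined from the \<open>s\<^sup>*\<^bsub>(k)\<^esub>\<close>, so its product formula says that these are the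
  coefficients of the product in the basis \<open>1 / u\<^bsup>\<down>k\<^esup>\<close>. The Jacobi--Trudi matrix of a single row
  is upper triangular with diagonal \<open>h\<^bsub>0,k\<^esub>, 1, 1, \<dots>\<close>.
\<close>

lemma Hstar_eq_complete_star: "Hstar = complete_star"
proof -
  define h where "h j k = (if k < 0 then 0 else
      expansion_coeff (shifted_basis star_cst j) complete_star (nat k))" for j and k :: int
  have h: "expands (shifted_basis star_cst j) (\<lambda>k. h j (int k)) complete_star" for j
    using expands_expansion_coeff[OF unitriangular_shifted_basis[OF comm_ring_hom_star_cst]]
    by (simp add: h_def)
  have neg: "h j k = 0" if "k < 0" for j k
    using that by (simp add: h_def)
  have h0: "h j 0 = 1" for j
  proof -
    have "complete_star $ 0 = 1"
      unfolding complete_star_def fps_nth_Abs_fps by transfer simp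
    then show ?thesis
      using expands_nth_0[OF unitriangular_shifted_basis[OF comm_ring_hom_star_cst] h[of j]]
      by (simp only: of_nat_0)
  qed
  have row: "shifted_schur [Suc k] = h 0 (int (Suc k))" for k
  proof (rule shifted_schur_jacobi_trudi[OF h])
    fix n assume n: "n \<ge> length [Suc k]"
    let ?J = "mat n n (\<lambda>(i, j). h j (int (part [Suc k] i) - int i + int j))"
    have "det ?J = (\<Prod>i=0..<n. ?J $$ (i, i))"
      by (subst det_upper_triangular[of _ n]) (auto simp: part_def neg prod_list_diag_prod)
    also have "\<dots> = (\<Prod>i=0..<n. if i = 0 then h 0 (int (Suc k)) else 1)"
      by (rule prod.cong) (auto simp: part_def h0)
    also have "\<dots> = h 0 (int (Suc k))"
      using n by (simp add: prod.delta)
    finally show "det ?J = h 0 (int (Suc k))" .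
  qed (simp add: neg)
  show ?thesis
  proof (rule fps_ext)
    fix m
    let ?B = "shifted_basis star_cst 0"
    have "complete_star $ m = (\<Sum>k\<le>m. h 0 (int k) * ?B k $ m)"
      using h by (simp add: expands_def)
    also have "\<dots> = ?B 0 $ m + (\<Sum>k<m. h 0 (int (Suc k)) * ?B (Suc k) $ m)"
      by (simp add: sum.atMost_shift h0)
    also have "\<dots> = Hstar $ m"
      by (simp only: Hstar_nth row) (simp add: shifted_basis_def)
    finally show "Hstar $ m = complete_star $ m" ..
  qed
qed

section \<open>The substitution of \<open>u + 1/2\<close>\<close>

text \<open>Replacing \<open>u\<close> by \<open>u + 1/2\<close> lowers all parameters by \<open>1/2\<close>.\<close>

lemma inv_prod_compose_half:
  "inv_prod b k oo (fps_X * inverse (1 + fps_const (1/2) * fps_X)) = inv_prod (\<lambda>i. b i - 1/2) k"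
proof -
  define v :: "complex fps" where "v = 1 + fps_const (1/2) * fps_X"
  define w where "w = fps_X * inverse v"
  have wv: "w * v = fps_X"
    using inverse_mult_eq_1[of v] by (simp add: v_def w_def mult.assoc)
  have w0: "w $ 0 = 0" by (simp add: w_def)
  have "inv_prod b k oo w = inv_prod (\<lambda>i. b i - 1/2) k"
  proof (induction k)
    case (Suc k)
    let ?\<beta> = "b (int k + 1)"
    let ?q = "1 - fps_const (?\<beta> - 1/2) * fps_X"
    have q: "v - fps_const ?\<beta> * fps_X = ?q"
      unfolding v_def by (simp add: fps_eq_iff algebra_simps)
    have "(inv_prod b (Suc k) oo w) * (1 - fps_const ?\<beta> * w) = w * (inv_prod b k oo w)"
      using arg_cong[OF inv_prod_Suc[of b k], of "\<lambda>F. F oo w"]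
      by (simp add: fps_compose_mult_distrib[OF w0] fps_compose_sub_distrib w0)
    then have "(inv_prod b (Suc k) oo w) * (1 - fps_const ?\<beta> * w) * v =
        w * (inv_prod b k oo w) * v"
      by (rule arg_cong)
    moreover have "(inv_prod b (Suc k) oo w) * (1 - fps_const ?\<beta> * w) * v =
        (inv_prod b (Suc k) oo w) * (v - fps_const ?\<beta> * (w * v))"
      by (simp add: algebra_simps)
    moreover have "w * (inv_prod b k oo w) * v = (w * v) * (inv_prod b k oo w)"
      by (simp only: mult_ac)
    ultimately have "(inv_prod b (Suc k) oo w) * ?q = fps_X * inv_prod (\<lambda>i. b i - 1/2) k"
      by (simp only: wv q Suc.IH)
    also have "\<dots> = inv_prod (\<lambda>i. b i - 1/2) (Suc k) * ?q"
      using inv_prod_Suc[of "\<lambda>i. b i - 1/2" k] by (simp only:)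
    finally have eq: "(inv_prod b (Suc k) oo w) * ?q = inv_prod (\<lambda>i. b i - 1/2) (Suc k) * ?q" .
    have "?q $ 0 \<noteq> 0" by simp
    then have "?q \<noteq> 0" by (metis fps_zero_nth)
    with eq show ?case by (metis mult_right_cancel)
  qed simp
  then show ?thesis by (simp only: v_def w_def)
qed

lemma expands_Hser_half:
  assumes "mult_h_expansion b h"
  shows "expands (\<lambda>k. map_coeffs cst (inv_prod (\<lambda>i. b i - 1/2) k)) h Hser_half"
  unfolding expands_def
proof
  fix m
  define w :: "complex fps" where "w = fps_X * inverse (1 + fps_const (1/2) * fps_X)"
  interpret map_coeffs: comm_ring_hom "map_coeffs cst"
    by (rule comm_ring_hom_map_coeffs[OF comm_ring_hom_cst])
  have pow: "map_coeffs cst w ^ i $ m = cst (w ^ i $ m)" for i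
    by (simp only: map_coeffs.hom_power[symmetric] map_coeffs_nth)
  have "Hser_half $ m = (\<Sum>i\<le>m. Hser $ i * cst (w ^ i $ m))"
    by (simp add: Hser_half_def fps_compose_nth pow atLeast0AtMost flip: w_def)
  also have "\<dots> = (\<Sum>i\<le>m. (\<Sum>k\<le>m. h k * cst (inv_prod b k $ i)) * cst (w ^ i $ m))"
  proof (rule sum.cong[OF refl])
    fix i assume "i \<in> {..m}"
    then have "(\<Sum>k\<le>m. h k * cst (inv_prod b k $ i)) = (\<Sum>k\<le>i. h k * cst (inv_prod b k $ i))"
      by (intro sum.mono_neutral_right) (auto simp: inv_prod_nth_less)
    then show "Hser $ i * cst (w ^ i $ m) =
        (\<Sum>k\<le>m. h k * cst (inv_prod b k $ i)) * cst (w ^ i $ m)"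
      using assms by (simp add: mult_h_expansion_iff)
  qed
  also have "\<dots> = (\<Sum>k\<le>m. h k * cst (\<Sum>i\<le>m. inv_prod b k $ i * w ^ i $ m))"
    unfolding sum_distrib_right cst_sum cst_mult sum_distrib_left mult.assoc
    by (rule sum.swap)
  also have "\<dots> = (\<Sum>k\<le>m. h k * cst ((inv_prod b k oo w) $ m))"
    by (simp add: fps_compose_nth atLeast0AtMost)
  finally show "Hser_half $ m = (\<Sum>k\<le>m. h k * map_coeffs cst (inv_prod (\<lambda>i. b i - 1/2) k) $ m)"
    by (simp add: w_def inv_prod_compose_half)
qed

section \<open>Multiparameter Schur functions and Frobenius--Schur functions\<close>

theorem proposition3p2:
  fixes a :: "int \<Rightarrow> complex"
    and \<phi> :: "lambda_star \<Rightarrow> cpoly"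
    and \<mu> :: "nat list"
  assumes "\<And>i. a i = of_int i - 1/2"
    and "frobenius_iso \<phi>"
    and "young_diagram \<mu>"
  shows "mult_schur a \<mu> = frobenius_schur \<phi> \<mu>"
proof -
  \<comment> \<open>The comparison takes place in \<open>\<Lambda>\<^sup>*\<close>, where the shifted Schur function is characterised.\<close>
  define \<psi> where "\<psi> = inv_into UNIV \<phi>"
  have \<phi>: "bij \<phi>" "\<And>f g. \<phi> (f + g) = \<phi> f + \<phi> g" "\<And>f g. \<phi> (f * g) = \<phi> f * \<phi> g"
    "\<And>c. \<phi> (star_cst c) = cst c" "map_coeffs \<phi> Hstar = Hser_half"
    using assms(2) by (auto simp: frobenius_iso_def algebra_iso_def)
  have \<phi>\<psi>: "\<phi> (\<psi> p) = p" and \<psi>\<phi>: "\<psi> (\<phi> f) = f" for p f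
    using \<phi>(1) by (simp_all add: \<psi>_def bij_is_inj bij_is_surj surj_f_inv_f)
  have \<psi>_cst: "\<psi> (cst c) = star_cst c" for c
    by (metis \<phi>(4) \<psi>\<phi>)
  interpret \<psi>: comm_ring_hom \<psi>
  proof
    show "\<psi> (p + q) = \<psi> p + \<psi> q" "\<psi> (p * q) = \<psi> p * \<psi> q" for p q
      by (metis \<phi>(2) \<phi>\<psi> \<psi>\<phi>, metis \<phi>(3) \<phi>\<psi> \<psi>\<phi>)
    show "\<psi> 0 = 0" "\<psi> 1 = 1"
      using \<psi>_cst[of 0] \<psi>_cst[of 1] by simp_all
  qed
  let ?h = "\<lambda>j k. mult_h (tau (- int j) a) k"
  have "map_coeffs \<psi> Hser_half = complete_star"
    by (simp add: \<phi>(5)[symmetric] \<psi>\<phi> fps_eq_iff flip: Hstar_eq_complete_star)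
  moreover have "(\<lambda>i. tau (- int j) a i - 1/2) = (\<lambda>i. of_int (i - 1) - of_nat j)" for j
    by (simp add: fun_eq_iff tau_def assms(1))
  ultimately have "expands (shifted_basis star_cst j) (\<lambda>k. \<psi> (?h j (int k))) complete_star" for j
    using expands_hom[OF \<psi>.comm_ring_hom_axioms
        expands_Hser_half[OF mult_h_expansion_mult_h[of "tau (- int j) a"]]]
    by (simp only: shifted_basis_def[abs_def] map_coeffs_map_coeffs \<psi>_cst)
  then have "shifted_schur \<mu> = \<psi> (mult_schur a \<mu>)"
  proof (rule shifted_schur_jacobi_trudi)
    fix n assume "length \<mu> \<le> n"
    let ?J = "mat n n (\<lambda>(i, j). ?h j (int (part \<mu> i) - int i + int j))"
    have "mat n n (\<lambda>(i, j). \<psi> (?h j (int (part \<mu> i) - int i + int j))) = map_mat \<psi> ?J"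
      by (rule eq_matI) auto
    then show "det (mat n n (\<lambda>(i, j). \<psi> (?h j (int (part \<mu> i) - int i + int j)))) =
        \<psi> (mult_schur a \<mu>)"
      \<comment> \<open>independence of the order holds already for multiparameter Schur functions\<close>
      using mult_schur_det_order[OF \<open>length \<mu> \<le> n\<close>, of a]
      by (simp add: mult_schur_det_def \<psi>.hom_det)
  qed (simp add: mult_h_neg)
  then show ?thesis
    by (simp add: frobenius_schur_def \<phi>\<psi>)
qed

end
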